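(* Let $(M,g)$ be a connected, complete, $C^\infty$ Riemannian manifold without boundary of dimension $n\ge2$, let $\psi\in C^\infty(M)$ and let $\mathfrak{m}=e^{-\psi}\mathrm{vol}_g$. For any $u\in C^\infty(M)$ and $N<0$, we have $$\Delta_{\mathfrak{m}}\left(\frac{|\nabla u|^2}{2}\right)-\langle\nabla\Delta_{\mathfrak{m}}u,\nabla u\rangle\ge\mathrm{Ric}_N(\nabla u)+\frac{(\Delta_{\mathfrak{m}}u)^2}{N}$$ on $M$.
   Context: $\mathrm{vol}_g$ is the Riemannian volume measure. The weighted Laplacian is $\Delta_{\mathfrak{m}}u:=\Delta u-\langle\nabla u,\nabla\psi\rangle$. The weighted Ricci curvature, for $N<0$ and $v\in TM$, is $\mathrm{Ric}_N(v):=\mathrm{Ric}(v)+\mathrm{Hess}\,\psi(v,v)-\frac{\langle\nabla\psi,v\rangle^2}{N-n}$, where $\mathrm{Ric}(v)=\mathrm{Ric}(v,v)$. *)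

theory Defs
  imports "HOL-Analysis.Analysis"
begin

section \<open>Smooth functions on open subsets of Euclidean space\<close>

text \<open>Meant for open \<open>S\<close>, where (the domain being finite-dimensional) it is the usual notion of
  having continuous directional derivatives of every order.\<close>

primrec Ck_on ::
    "nat \<Rightarrow> 'a::euclidean_space set \<Rightarrow> ('a \<Rightarrow> 'b::real_normed_vector) \<Rightarrow> bool" where
  "Ck_on 0 S f \<longleftrightarrow> continuous_on S f"
| "Ck_on (Suc k) S f \<longleftrightarrow>
     (\<forall>x\<in>S. f differentiable (at x)) \<and> (\<forall>v. Ck_on k S (\<lambda>x. frechet_derivative f (at x) v))"

definition smooth_on :: "'a::euclidean_space set \<Rightarrow> ('a \<Rightarrow> 'b::real_normed_vector) \<Rightarrow> bool" where
  "smooth_on S f \<longleftrightarrow> (\<forall>k. Ck_on k S f)"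

definition partial :: "'n \<Rightarrow> (real^'n \<Rightarrow> real) \<Rightarrow> real^'n::finite \<Rightarrow> real" where
  "partial i f x = frechet_derivative f (at x) (axis i 1)"

section \<open>Smooth manifolds without boundary\<close>

text \<open>A chart is a pair \<open>(U, \<phi>)\<close>; the values of \<open>\<phi>\<close> outside \<open>U\<close> are irrelevant. Likewise a
  tangent vector at \<open>p\<close> is an operator on real functions defined near \<open>p\<close>, and such functions are
  represented by total functions.\<close>

type_synonym ('a, 'n) chart = "'a set \<times> ('a \<Rightarrow> real^'n)"
type_synonym 'a tvec = "('a \<Rightarrow> real) \<Rightarrow> real"

definition chart_inv :: "('a, 'n::finite) chart \<Rightarrow> real^'n \<Rightarrow> 'a" where
  "chart_inv c = inv_into (fst c) (snd c)"

definition is_chart :: "'a topology \<Rightarrow> ('a, 'n::finite) chart \<Rightarrow> bool" where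
  "is_chart X c \<longleftrightarrow> openin X (fst c) \<and> open (snd c ` fst c) \<and>
     homeomorphic_map (subtopology X (fst c)) (top_of_set (snd c ` fst c)) (snd c)"

definition second_countable_space :: "'a topology \<Rightarrow> bool" where
  "second_countable_space X \<longleftrightarrow>
     (\<exists>\<B>. countable \<B> \<and> (\<forall>B\<in>\<B>. openin X B) \<and>
        (\<forall>W. openin X W \<longrightarrow> (\<exists>\<C>\<subseteq>\<B>. W = \<Union>\<C>)))"

definition smooth_atlas :: "'a topology \<Rightarrow> ('a, 'n::finite) chart set \<Rightarrow> bool" where
  "smooth_atlas X A \<longleftrightarrow>
     (\<forall>c\<in>A. is_chart X c) \<and> (\<Union>c\<in>A. fst c) = topspace X \<and>
     (\<forall>c\<in>A. \<forall>d\<in>A. smooth_on (snd c ` (fst c \<inter> fst d)) (snd d \<circ> chart_inv c))"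

text \<open>The atlas need not be maximal: any atlas determines the smooth structure. The dimension is
  \<open>CARD('n)\<close>.\<close>

record ('a, 'n::finite) riem_manifold =
  mtop :: "'a topology"
  atlas :: "('a, 'n) chart set"
  gmetric :: "'a \<Rightarrow> 'a tvec \<Rightarrow> 'a tvec \<Rightarrow> real"

definition smooth_fun :: "('a, 'n::finite) riem_manifold \<Rightarrow> ('a \<Rightarrow> real) \<Rightarrow> bool" where
  "smooth_fun M f \<longleftrightarrow> (\<forall>c\<in>atlas M. smooth_on (snd c ` fst c) (f \<circ> chart_inv c))"

definition smooth_near :: "('a, 'n::finite) riem_manifold \<Rightarrow> 'a \<Rightarrow> ('a \<Rightarrow> real) \<Rightarrow> bool" where
  "smooth_near M p f \<longleftrightarrow>
     (\<exists>W. openin (mtop M) W \<and> p \<in> W \<and>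
        (\<forall>c\<in>atlas M. smooth_on (snd c ` (fst c \<inter> W)) (f \<circ> chart_inv c)))"

text \<open>Tangent vectors are directional derivatives acting on functions that are smooth near \<open>p\<close>.
  Setting them to \<open>0\<close> on all other functions makes equality of tangent vectors independent of the
  chart.\<close>

definition chart_vec ::
    "('a, 'n::finite) riem_manifold \<Rightarrow> ('a, 'n) chart \<Rightarrow> 'a \<Rightarrow> real^'n \<Rightarrow> 'a tvec" where
  "chart_vec M c p a = (\<lambda>f. if smooth_near M p f
     then frechet_derivative (f \<circ> chart_inv c) (at (snd c p)) a else 0)"

definition tangent_space :: "('a, 'n::finite) riem_manifold \<Rightarrow> 'a \<Rightarrow> 'a tvec set" where
  "tangent_space M p = {chart_vec M c p a | c a. c \<in> atlas M \<and> p \<in> fst c}"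

definition vcomp :: "('a, 'n::finite) chart \<Rightarrow> 'a tvec \<Rightarrow> 'n \<Rightarrow> real" where
  "vcomp c v i = v (\<lambda>q. snd c q $ i)"

section \<open>Riemannian manifolds\<close>

definition metric_coeff ::
    "('a, 'n::finite) riem_manifold \<Rightarrow> ('a, 'n) chart \<Rightarrow> real^'n \<Rightarrow> real^'n^'n" where
  "metric_coeff M c x = (let p = chart_inv c x in
     (\<chi> i j. gmetric M p (chart_vec M c p (axis i 1)) (chart_vec M c p (axis j 1))))"

definition riemannian_metric :: "('a, 'n::finite) riem_manifold \<Rightarrow> bool" where
  "riemannian_metric M \<longleftrightarrow>
     (\<forall>p\<in>topspace (mtop M).
        (\<forall>v\<in>tangent_space M p. \<forall>w\<in>tangent_space M p. gmetric M p v w = gmetric M p w v) \<and>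
        (\<forall>v\<in>tangent_space M p. \<forall>v'\<in>tangent_space M p. \<forall>w\<in>tangent_space M p. \<forall>a b.
           gmetric M p (\<lambda>f. a * v f + b * v' f) w = a * gmetric M p v w + b * gmetric M p v' w) \<and>
        (\<forall>v\<in>tangent_space M p. v \<noteq> (\<lambda>f. 0) \<longrightarrow> gmetric M p v v > 0)) \<and>
     (\<forall>c\<in>atlas M. \<forall>i j. smooth_on (snd c ` fst c) (\<lambda>x. metric_coeff M c x $ i $ j))"

definition riemannian_manifold :: "('a, 'n::finite) riem_manifold \<Rightarrow> bool" where
  "riemannian_manifold M \<longleftrightarrow>
     Hausdorff_space (mtop M) \<and> second_countable_space (mtop M) \<and>
     smooth_atlas (mtop M) (atlas M) \<and> riemannian_metric M"

subsection \<open>Distance and completeness\<close>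

text \<open>Curves are continuous on \<open>[0,1]\<close> and \<open>C\<^sup>1\<close> off a finite set. Their velocities may be
  unbounded near the exceptional points, so lengths take values in \<^typ>\<open>ennreal\<close>; this does not affect
  the infimum. On a connected manifold the infimum is finite, so \<open>riem_dist\<close> loses no information
  there.\<close>

definition curves :: "('a, 'n::finite) riem_manifold \<Rightarrow> 'a \<Rightarrow> 'a \<Rightarrow> (real \<Rightarrow> 'a) set" where
  "curves M p q = {\<gamma>. continuous_map (top_of_set {0..1}) (mtop M) \<gamma> \<and> \<gamma> 0 = p \<and> \<gamma> 1 = q \<and>
     (\<exists>S. finite S \<and>
        (\<forall>c\<in>atlas M. (snd c \<circ> \<gamma>) C1_differentiable_on ({t\<in>{0<..<1}. \<gamma> t \<in> fst c} - S)))}"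

definition velocity :: "('a, 'n::finite) riem_manifold \<Rightarrow> (real \<Rightarrow> 'a) \<Rightarrow> real \<Rightarrow> 'a tvec" where
  "velocity M \<gamma> t =
     (\<lambda>f. if smooth_near M (\<gamma> t) f then vector_derivative (f \<circ> \<gamma>) (at t) else 0)"

definition curve_length :: "('a, 'n::finite) riem_manifold \<Rightarrow> (real \<Rightarrow> 'a) \<Rightarrow> ennreal" where
  "curve_length M \<gamma> = (\<integral>\<^sup>+t\<in>{0<..<1}.
     ennreal (sqrt (gmetric M (\<gamma> t) (velocity M \<gamma> t) (velocity M \<gamma> t))) \<partial>lborel)"

definition riem_dist :: "('a, 'n::finite) riem_manifold \<Rightarrow> 'a \<Rightarrow> 'a \<Rightarrow> real" where
  "riem_dist M p q = enn2real (INF \<gamma>\<in>curves M p q. curve_length M \<gamma>)"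

definition complete_riemannian :: "('a, 'n::finite) riem_manifold \<Rightarrow> bool" where
  "complete_riemannian M \<longleftrightarrow> Metric_space.mcomplete (topspace (mtop M)) (riem_dist M)"

subsection \<open>Volume\<close>

definition riem_volume :: "('a, 'n::finite) riem_manifold \<Rightarrow> 'a measure" where
  "riem_volume M = (THE \<mu>. space \<mu> = topspace (mtop M) \<and>
     sets \<mu> = sigma_sets (topspace (mtop M)) {W. openin (mtop M) W} \<and>
     (\<forall>c\<in>atlas M. \<forall>B\<in>sets \<mu>. B \<subseteq> fst c \<longrightarrow>
        emeasure \<mu> B = (\<integral>\<^sup>+x\<in>snd c ` B. ennreal (sqrt (det (metric_coeff M c x))) \<partial>lborel)))"

definition weighted_volume ::
    "('a, 'n::finite) riem_manifold \<Rightarrow> ('a \<Rightarrow> real) \<Rightarrow> 'a measure" where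
  "weighted_volume M \<psi> = density (riem_volume M) (\<lambda>p. ennreal (exp (- \<psi> p)))"

subsection \<open>Levi-Civita connection and curvature in a chart\<close>

definition inv_metric_coeff ::
    "('a, 'n::finite) riem_manifold \<Rightarrow> ('a, 'n) chart \<Rightarrow> real^'n \<Rightarrow> real^'n^'n" where
  "inv_metric_coeff M c x = matrix_inv (metric_coeff M c x)"

text \<open>\<open>christoffel M c k i j\<close> is \<open>\<Gamma>\<^sup>k\<^sub>i\<^sub>j\<close>, that is
  \<open>\<nabla>\<^bsub>\<partial>\<^sub>i\<^esub> \<partial>\<^sub>j = \<Sum>k. \<Gamma>\<^sup>k\<^sub>i\<^sub>j \<partial>\<^sub>k\<close>.\<close>

definition christoffel ::
    "('a, 'n::finite) riem_manifold \<Rightarrow> ('a, 'n) chart \<Rightarrow> 'n \<Rightarrow> 'n \<Rightarrow> 'n \<Rightarrow> real^'n \<Rightarrow> real" where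
  "christoffel M c k i j x = (\<Sum>l\<in>UNIV. inv_metric_coeff M c x $ k $ l *
     (partial i (\<lambda>y. metric_coeff M c y $ j $ l) x + partial j (\<lambda>y. metric_coeff M c y $ i $ l) x
      - partial l (\<lambda>y. metric_coeff M c y $ i $ j) x)) / 2"

text \<open>\<open>riemann_coeff M c l i j k\<close> is the \<open>\<partial>\<^sub>l\<close>-component of \<open>R(\<partial>\<^sub>i, \<partial>\<^sub>j) \<partial>\<^sub>k\<close>, where
  \<open>R(X, Y) Z = \<nabla>\<^bsub>X\<^esub> \<nabla>\<^bsub>Y\<^esub> Z - \<nabla>\<^bsub>Y\<^esub> \<nabla>\<^bsub>X\<^esub> Z - \<nabla>\<^bsub>[X, Y]\<^esub> Z\<close>. The Ricci tensor \<open>Ric(Y, Z)\<close> is the trace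
  of \<open>X \<mapsto> R(X, Y) Z\<close>, hence positive on round spheres.\<close>

definition riemann_coeff ::
    "('a, 'n::finite) riem_manifold \<Rightarrow> ('a, 'n) chart \<Rightarrow> 'n \<Rightarrow> 'n \<Rightarrow> 'n \<Rightarrow> 'n \<Rightarrow> real^'n \<Rightarrow> real" where
  "riemann_coeff M c l i j k x =
     partial i (christoffel M c l j k) x - partial j (christoffel M c l i k) x +
     (\<Sum>m\<in>UNIV. christoffel M c m j k x * christoffel M c l i m x
              - christoffel M c m i k x * christoffel M c l j m x)"

definition ricci_coeff ::
    "('a, 'n::finite) riem_manifold \<Rightarrow> ('a, 'n) chart \<Rightarrow> 'n \<Rightarrow> 'n \<Rightarrow> real^'n \<Rightarrow> real" where
  "ricci_coeff M c j k x = (\<Sum>i\<in>UNIV. riemann_coeff M c i i j k x)"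

definition hess_coeff ::
    "('a, 'n::finite) riem_manifold \<Rightarrow> ('a, 'n) chart \<Rightarrow> ('a \<Rightarrow> real) \<Rightarrow> 'n \<Rightarrow> 'n \<Rightarrow> real^'n \<Rightarrow> real"
  where
  "hess_coeff M c f i j x = partial i (partial j (f \<circ> chart_inv c)) x
     - (\<Sum>k\<in>UNIV. christoffel M c k i j x * partial k (f \<circ> chart_inv c) x)"

subsection \<open>Operators on the manifold\<close>

text \<open>The tensors below do not depend on the chart in which they are computed, so evaluating them at
  \<open>p\<close> in an arbitrarily selected chart around \<open>p\<close> is legitimate.\<close>

definition chart_at :: "('a, 'n::finite) riem_manifold \<Rightarrow> 'a \<Rightarrow> ('a, 'n) chart" where
  "chart_at M p = (SOME c. c \<in> atlas M \<and> p \<in> fst c)"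

definition gradient :: "('a, 'n::finite) riem_manifold \<Rightarrow> ('a \<Rightarrow> real) \<Rightarrow> 'a \<Rightarrow> 'a tvec" where
  "gradient M f p =
     (THE v. v \<in> tangent_space M p \<and> (\<forall>w\<in>tangent_space M p. gmetric M p v w = w f))"

definition Hess :: "('a, 'n::finite) riem_manifold \<Rightarrow> ('a \<Rightarrow> real) \<Rightarrow> 'a \<Rightarrow> 'a tvec \<Rightarrow> 'a tvec \<Rightarrow> real"
  where
  "Hess M f p v w = (let c = chart_at M p in
     \<Sum>i\<in>UNIV. \<Sum>j\<in>UNIV. hess_coeff M c f i j (snd c p) * vcomp c v i * vcomp c w j)"

text \<open>The Laplacian is the metric trace of the Hessian (a nonpositive operator).\<close>

definition laplacian :: "('a, 'n::finite) riem_manifold \<Rightarrow> ('a \<Rightarrow> real) \<Rightarrow> 'a \<Rightarrow> real" where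
  "laplacian M f p = (let c = chart_at M p; x = snd c p in
     \<Sum>i\<in>UNIV. \<Sum>j\<in>UNIV. inv_metric_coeff M c x $ i $ j * hess_coeff M c f i j x)"

definition Ric :: "('a, 'n::finite) riem_manifold \<Rightarrow> 'a \<Rightarrow> 'a tvec \<Rightarrow> 'a tvec \<Rightarrow> real" where
  "Ric M p v w = (let c = chart_at M p in
     \<Sum>i\<in>UNIV. \<Sum>j\<in>UNIV. ricci_coeff M c i j (snd c p) * vcomp c v i * vcomp c w j)"

section \<open>Weighted Laplacian and weighted Ricci curvature\<close>

definition weighted_laplacian ::
    "('a, 'n::finite) riem_manifold \<Rightarrow> ('a \<Rightarrow> real) \<Rightarrow> ('a \<Rightarrow> real) \<Rightarrow> 'a \<Rightarrow> real" where
  "weighted_laplacian M \<psi> u p =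
     laplacian M u p - gmetric M p (gradient M u p) (gradient M \<psi> p)"

definition weighted_Ric ::
    "('a, 'n::finite) riem_manifold \<Rightarrow> ('a \<Rightarrow> real) \<Rightarrow> real \<Rightarrow> 'a \<Rightarrow> 'a tvec \<Rightarrow> real" where
  "weighted_Ric M \<psi> N p v =
     Ric M p v v + Hess M \<psi> p v v - (gmetric M p (gradient M \<psi> p) v)\<^sup>2 / (N - real CARD('n))"

end

theory Submission
  imports Defs
begin

text \<open>The inequality is pointwise and follows from Bochner's formula
\<open>\<Delta>(|\<nabla>u|\<^sup>2 / 2) - \<langle>\<nabla>\<Delta>u, \<nabla>u\<rangle> = Ric(\<nabla>u, \<nabla>u) + |Hess u|\<^sup>2\<close>. Passing to the weighted Laplacian adds
\<open>Hess \<psi>(\<nabla>u, \<nabla>u)\<close> on the right, because the other second-order terms involving \<open>\<psi>\<close> cancel. Then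
\<open>|Hess u|\<^sup>2 \<ge> (\<Delta>u)\<^sup>2 / n\<close>, and with \<open>t = \<Delta>u\<close>, \<open>b = \<langle>\<nabla>u, \<nabla>\<psi>\<rangle>\<close> and \<open>t - b\<close> the weighted Laplacian of \<open>u\<close>, the
claim reduces to \<open>t\<^sup>2 / n \<ge> - b\<^sup>2 / (N - n) + (t - b)\<^sup>2 / N\<close>, which is Cauchy--Schwarz for \<open>N < 0\<close>
(\<open>weighted_square_ineq\<close>).

Bochner's formula (\<open>bochner\<close>) is proved in arbitrary coordinates. For a gradient field \<open>X\<close>, the
covariant derivative \<open>\<nabla>X\<close> is the Hessian \<open>A\<close> with an index raised (\<open>partial_grad\<close>), and the gradient of
\<open>|X|\<^sup>2 / 2\<close> is \<open>A X\<close>. The divergence of \<open>A X\<close> yields \<open>tr (A\<^sup>2)\<close> and a divergence of \<open>A\<close>, which the contracted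
Ricci identity (\<open>contracted_ricci_identity\<close>) compares with the differential of \<open>tr A = \<Delta>u\<close>.

The formula differentiates \<open>\<Delta>u\<close>, whose value at each point is computed in a chart selected for that point, so
the Laplacian has to be shown independent of the chart (\<open>laplacian_eq\<close>). This uses the identity
\<open>2 Hess f(\<nabla>h, \<nabla>k) = \<langle>\<nabla>h, \<nabla>\<langle>\<nabla>f, \<nabla>k\<rangle>\<rangle> + \<langle>\<nabla>k, \<nabla>\<langle>\<nabla>f, \<nabla>h\<rangle>\<rangle> - \<langle>\<nabla>f, \<nabla>\<langle>\<nabla>h, \<nabla>k\<rangle>\<rangle>\<close>, whose right-hand side involves
only gradients and the metric. Applied to coordinate functions, it determines the metric trace
of the Hessian (\<open>laplace_coeff_by_coords\<close>).\<close>

section \<open>Smooth functions and partial derivatives\<close>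

lemma frechet_derivative_eqI: "(f has_derivative f') (at x) \<Longrightarrow> frechet_derivative f (at x) = f'"
  using frechet_derivative_at by metis

lemma Ck_on_cong:
  assumes "open S" "\<And>x. x \<in> S \<Longrightarrow> f x = g x" "Ck_on k S f"
  shows "Ck_on k S g"
  using assms(2,3)
proof (induction k arbitrary: f g)
  case 0
  then show ?case by (metis Ck_on.simps(1) continuous_on_cong)
next
  case (Suc k)
  have d: "f differentiable (at x)" if "x \<in> S" for x using Suc.prems(2) that by simp
  have e: "frechet_derivative f (at x) = frechet_derivative g (at x)" if "x \<in> S" for x
    using frechet_derivative_transform_within_open[OF d[OF that] \<open>open S\<close> that] Suc.prems(1) by blast
  have "g differentiable (at x)" if "x \<in> S" for x
    using d[OF that] has_derivative_transform_within_open[OF _ \<open>open S\<close> that] Suc.prems(1)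
    unfolding differentiable_def by blast
  moreover have "Ck_on k S (\<lambda>x. frechet_derivative g (at x) v)" for v
    by (rule Suc.IH[of "\<lambda>x. frechet_derivative f (at x) v"]) (use Suc.prems e in auto)
  ultimately show ?case by simp
qed

lemma Ck_on_Suc_imp: "Ck_on (Suc k) S f \<Longrightarrow> Ck_on k S f"
proof (induction k arbitrary: f)
  case 0
  then show ?case
    by (auto intro!: continuous_at_imp_continuous_on differentiable_imp_continuous_within)
next
  case (Suc k)
  then show ?case by (metis Ck_on.simps(2))
qed

lemma Ck_on_subset: "Ck_on k S f \<Longrightarrow> T \<subseteq> S \<Longrightarrow> Ck_on k T f"
  by (induction k arbitrary: f) (auto intro: continuous_on_subset)

lemma Ck_on_const: "Ck_on k S (\<lambda>x. c)"
  by (induction k arbitrary: c) auto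

lemma Ck_on_add:
  assumes "open S" "Ck_on k S f" "Ck_on k S g"
  shows "Ck_on k S (\<lambda>x. f x + g x)"
  using assms(2,3)
proof (induction k arbitrary: f g)
  case 0 then show ?case by (auto intro: continuous_intros)
next
  case (Suc k)
  have d: "((\<lambda>x. f x + g x) has_derivative
      (\<lambda>v. frechet_derivative f (at x) v + frechet_derivative g (at x) v)) (at x)" if "x \<in> S" for x
    using Suc.prems that by (auto intro!: has_derivative_add simp: frechet_derivative_works[symmetric])
  have "Ck_on k S (\<lambda>x. frechet_derivative (\<lambda>x. f x + g x) (at x) v)" for v
    by (rule Ck_on_cong[OF \<open>open S\<close>, of "\<lambda>x. frechet_derivative f (at x) v + frechet_derivative g (at x) v"])
       (use Suc frechet_derivative_eqI[OF d] in auto)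
  then show ?case using d by (auto simp: differentiable_def)
qed

lemma Ck_on_mult:
  fixes f g :: "'a::euclidean_space \<Rightarrow> real"
  assumes "open S" "Ck_on k S f" "Ck_on k S g"
  shows "Ck_on k S (\<lambda>x. f x * g x)"
  using assms(2,3)
proof (induction k arbitrary: f g)
  case 0 then show ?case by (auto intro: continuous_intros)
next
  case (Suc k)
  have d: "((\<lambda>x. f x * g x) has_derivative
      (\<lambda>v. f x * frechet_derivative g (at x) v + frechet_derivative f (at x) v * g x)) (at x)"
    if "x \<in> S" for x
    using Suc.prems that by (auto intro!: has_derivative_mult simp: frechet_derivative_works[symmetric])
  have "Ck_on k S (\<lambda>x. frechet_derivative (\<lambda>x. f x * g x) (at x) v)" for v
    by (rule Ck_on_cong[OF \<open>open S\<close>, of "\<lambda>x. f x * frechet_derivative g (at x) v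
          + frechet_derivative f (at x) v * g x"])
       (use Suc frechet_derivative_eqI[OF d] in \<open>auto intro!: Ck_on_add[OF \<open>open S\<close>] simp: Ck_on_Suc_imp\<close>)
  then show ?case using d by (auto simp: differentiable_def)
qed

lemma Ck_on_inverse:
  fixes f :: "'a::euclidean_space \<Rightarrow> real"
  assumes "open S" "Ck_on k S f" "\<And>x. x \<in> S \<Longrightarrow> f x \<noteq> 0"
  shows "Ck_on k S (\<lambda>x. inverse (f x))"
  using assms(2)
proof (induction k)
  case 0 then show ?case using assms(3) by (auto intro: continuous_intros)
next
  case (Suc k)
  have d: "((\<lambda>x. inverse (f x)) has_derivative
      (\<lambda>v. (-1) * (inverse (f x) * frechet_derivative f (at x) v * inverse (f x)))) (at x)"
    if "x \<in> S" for x
    using Suc.prems that assms(3) has_derivative_inverse[where f=f and x=x and f'="frechet_derivative f (at x)" and S=UNIV]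
    by (auto simp: frechet_derivative_works[symmetric])
  have "Ck_on k S (\<lambda>x. frechet_derivative (\<lambda>x. inverse (f x)) (at x) v)" for v
    by (rule Ck_on_cong[OF \<open>open S\<close>,
          of "\<lambda>x. (-1) * (inverse (f x) * frechet_derivative f (at x) v * inverse (f x))"])
       (use Suc Ck_on_Suc_imp[OF Suc.prems] frechet_derivative_eqI[OF d]
        in \<open>simp_all only: Ck_on_mult[OF \<open>open S\<close>] Ck_on_const Ck_on.simps\<close>)
  then show ?case using d by (auto simp: differentiable_def)
qed

lemma Ck_on_bounded_linear:
  assumes "open S" "bounded_linear L" "Ck_on k S f"
  shows "Ck_on k S (\<lambda>x. L (f x))"
  using assms(3)
proof (induction k arbitrary: f)
  case 0 then show ?case using assms(2) by (auto intro: linear_continuous_on_compose bounded_linear.continuous_on)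
next
  case (Suc k)
  have d: "((\<lambda>x. L (f x)) has_derivative (\<lambda>v. L (frechet_derivative f (at x) v))) (at x)"
    if "x \<in> S" for x
    using Suc.prems that
    by (auto intro!: bounded_linear.has_derivative[OF assms(2)] simp: frechet_derivative_works[symmetric])
  have "Ck_on k S (\<lambda>x. frechet_derivative (\<lambda>x. L (f x)) (at x) v)" for v
    by (rule Ck_on_cong[OF \<open>open S\<close>, of "\<lambda>x. L (frechet_derivative f (at x) v)"])
       (use Suc frechet_derivative_eqI[OF d] in auto)
  then show ?case using d by (auto simp: differentiable_def)
qed

lemma smooth_on_cong:
  "open S \<Longrightarrow> (\<And>x. x \<in> S \<Longrightarrow> f x = g x) \<Longrightarrow> smooth_on S f \<Longrightarrow> smooth_on S g"
  unfolding smooth_on_def using Ck_on_cong by metis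

lemma smooth_on_subset: "smooth_on S f \<Longrightarrow> T \<subseteq> S \<Longrightarrow> smooth_on T f"
  unfolding smooth_on_def using Ck_on_subset by metis

lemma smooth_on_const: "smooth_on S (\<lambda>x. c)"
  unfolding smooth_on_def using Ck_on_const by metis

lemma smooth_on_add: "open S \<Longrightarrow> smooth_on S f \<Longrightarrow> smooth_on S g \<Longrightarrow> smooth_on S (\<lambda>x. f x + g x)"
  unfolding smooth_on_def using Ck_on_add by metis

lemma smooth_on_mult:
  fixes f g :: "'a::euclidean_space \<Rightarrow> real"
  shows "open S \<Longrightarrow> smooth_on S f \<Longrightarrow> smooth_on S g \<Longrightarrow> smooth_on S (\<lambda>x. f x * g x)"
  unfolding smooth_on_def using Ck_on_mult by metis

lemma smooth_on_diff:
  fixes f g :: "'a::euclidean_space \<Rightarrow> real"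
  assumes "open S" "smooth_on S f" "smooth_on S g"
  shows "smooth_on S (\<lambda>x. f x - g x)"
  using smooth_on_add[OF assms(1,2) smooth_on_mult[OF assms(1) smooth_on_const[of S "-1"] assms(3)]]
  by simp

lemma smooth_on_divide:
  fixes f g :: "'a::euclidean_space \<Rightarrow> real"
  assumes "open S" "smooth_on S f" "smooth_on S g" "\<And>x. x \<in> S \<Longrightarrow> g x \<noteq> 0"
  shows "smooth_on S (\<lambda>x. f x / g x)"
  unfolding divide_inverse
  by (intro smooth_on_mult assms) (use assms Ck_on_inverse[OF assms(1)] in \<open>auto simp: smooth_on_def\<close>)

lemma smooth_on_sum:
  "open S \<Longrightarrow> (\<And>i. i \<in> I \<Longrightarrow> smooth_on S (f i)) \<Longrightarrow> smooth_on S (\<lambda>x. \<Sum>i\<in>I. f i x)"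
  by (induction I rule: infinite_finite_induct) (auto intro: smooth_on_add smooth_on_const)

lemma smooth_on_prod:
  fixes f :: "'i \<Rightarrow> 'a::euclidean_space \<Rightarrow> real"
  shows "open S \<Longrightarrow> (\<And>i. i \<in> I \<Longrightarrow> smooth_on S (f i)) \<Longrightarrow> smooth_on S (\<lambda>x. \<Prod>i\<in>I. f i x)"
  by (induction I rule: infinite_finite_induct) (auto intro: smooth_on_mult smooth_on_const)

lemma smooth_on_det:
  fixes A :: "'a::euclidean_space \<Rightarrow> real^'n^'n"
  assumes "open S" "\<And>i j. smooth_on S (\<lambda>x. A x $ i $ j)"
  shows "smooth_on S (\<lambda>x. det (A x))"
  unfolding det_def
  by (intro smooth_on_sum smooth_on_mult smooth_on_prod smooth_on_const assms)

lemma smooth_on_nth: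
  fixes f :: "'a::euclidean_space \<Rightarrow> real^'n"
  shows "open S \<Longrightarrow> smooth_on S f \<Longrightarrow> smooth_on S (\<lambda>x. f x $ i)"
  unfolding smooth_on_def using Ck_on_bounded_linear[OF _ bounded_linear_vec_nth] by metis

lemma smooth_on_differentiable: "smooth_on S f \<Longrightarrow> x \<in> S \<Longrightarrow> f differentiable (at x)"
  unfolding smooth_on_def by (metis Ck_on.simps(2))

lemma smooth_on_frechet: "smooth_on S f \<Longrightarrow> smooth_on S (\<lambda>x. frechet_derivative f (at x) v)"
  unfolding smooth_on_def by (metis Ck_on.simps(2))

lemma smooth_on_continuous: "smooth_on S f \<Longrightarrow> continuous_on S f"
  unfolding smooth_on_def by (metis Ck_on.simps(1))

text \<open>The mean value theorem, applied first in direction \<open>v\<close> and then in direction \<open>w\<close>, turns the second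
difference of \<open>f\<close> into a mixed second derivative at a nearby point. The second difference is symmetric
in \<open>v\<close> and \<open>w\<close>, the mixed derivative is not visibly so; comparing the two orders gives Schwarz's theorem.\<close>

lemma second_difference_mvt:
  fixes f :: "'a::euclidean_space \<Rightarrow> real"
  assumes S: "open S" "smooth_on S f" and B: "ball x e \<subseteq> S" and t: "t > 0" "t * (norm v + norm w) < e"
  obtains z where "dist z x \<le> t * (norm v + norm w)"
    "f (x + t *\<^sub>R v + t *\<^sub>R w) - f (x + t *\<^sub>R v) - f (x + t *\<^sub>R w) + f x
      = t * (t * frechet_derivative (\<lambda>y. frechet_derivative f (at y) v) (at z) w)"
proof -
  let ?D = "\<lambda>y. frechet_derivative f (at y)"
  let ?D2 = "\<lambda>z. frechet_derivative (\<lambda>y. frechet_derivative f (at y) v) (at z)"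
  have near: "dist (x + a *\<^sub>R v + b *\<^sub>R w) x \<le> t * (norm v + norm w)"
    if "0 \<le> a" "a \<le> t" "0 \<le> b" "b \<le> t" for a b
  proof -
    have "norm (a *\<^sub>R v + b *\<^sub>R w) \<le> norm (a *\<^sub>R v) + norm (b *\<^sub>R w)" by (rule norm_triangle_ineq)
    also have "\<dots> \<le> t * norm v + t * norm w"
      using that by (auto intro!: add_mono mult_right_mono)
    finally show ?thesis by (simp add: dist_norm algebra_simps)
  qed
  have inS: "x + a *\<^sub>R v + b *\<^sub>R w \<in> S" if "0 \<le> a" "a \<le> t" "0 \<le> b" "b \<le> t" for a b
    using near[OF that] t B by (auto simp: subset_iff dist_commute)
  have df: "(f has_derivative ?D y) (at y)" if "y \<in> S" for y
    using smooth_on_differentiable[OF S(2) that] frechet_derivative_works by blast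
  have dg: "((\<lambda>y. ?D y v) has_derivative ?D2 y) (at y)" if "y \<in> S" for y
    using smooth_on_differentiable[OF smooth_on_frechet[OF S(2)] that] frechet_derivative_works by blast
  let ?\<phi> = "\<lambda>a. f (x + a *\<^sub>R v + t *\<^sub>R w) - f (x + a *\<^sub>R v)"
  have d1: "(?\<phi> has_real_derivative (?D (x + a *\<^sub>R v + t *\<^sub>R w) v - ?D (x + a *\<^sub>R v) v)) (at a)"
    if "0 \<le> a" "a \<le> t" for a
  proof -
    have i: "x + a *\<^sub>R v + t *\<^sub>R w \<in> S" "x + a *\<^sub>R v \<in> S"
      using inS[of a t] inS[of a 0] that t by auto
    have "((\<lambda>a. f (x + a *\<^sub>R v + t *\<^sub>R w)) has_derivative (\<lambda>h. ?D (x + a *\<^sub>R v + t *\<^sub>R w) (h *\<^sub>R v))) (at a)"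
      by (rule has_derivative_compose[of "\<lambda>a. x + a *\<^sub>R v + t *\<^sub>R w", OF _ df[OF i(1)]])
         (auto intro!: derivative_eq_intros)
    moreover have "((\<lambda>a. f (x + a *\<^sub>R v)) has_derivative (\<lambda>h. ?D (x + a *\<^sub>R v) (h *\<^sub>R v))) (at a)"
      by (rule has_derivative_compose[of "\<lambda>a. x + a *\<^sub>R v", OF _ df[OF i(2)]])
         (auto intro!: derivative_eq_intros)
    ultimately have *: "(?\<phi> has_derivative
        (\<lambda>h. ?D (x + a *\<^sub>R v + t *\<^sub>R w) (h *\<^sub>R v) - ?D (x + a *\<^sub>R v) (h *\<^sub>R v))) (at a)"
      by (rule has_derivative_diff)
    show ?thesis
      unfolding has_field_derivative_def
      by (rule has_derivative_eq_rhs[OF *])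
         (use i[THEN df] in \<open>auto simp: has_derivative_def linear_simps algebra_simps\<close>)
  qed
  obtain a where a: "0 < a" "a < t"
    "?\<phi> t - ?\<phi> 0 = (t - 0) * (?D (x + a *\<^sub>R v + t *\<^sub>R w) v - ?D (x + a *\<^sub>R v) v)"
    using MVT2[of 0 t ?\<phi>, OF t(1) d1] by blast
  let ?\<chi> = "\<lambda>b. ?D (x + a *\<^sub>R v + b *\<^sub>R w) v"
  have d2: "(?\<chi> has_real_derivative (?D2 (x + a *\<^sub>R v + b *\<^sub>R w) w)) (at b)"
    if "0 \<le> b" "b \<le> t" for b
  proof -
    have i: "x + a *\<^sub>R v + b *\<^sub>R w \<in> S" using inS that a by auto
    have *: "(?\<chi> has_derivative (\<lambda>h. ?D2 (x + a *\<^sub>R v + b *\<^sub>R w) (h *\<^sub>R w))) (at b)"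
      by (rule has_derivative_compose[of "\<lambda>b. x + a *\<^sub>R v + b *\<^sub>R w", OF _ dg[OF i]])
         (auto intro!: derivative_eq_intros)
    show ?thesis
      unfolding has_field_derivative_def
      by (rule has_derivative_eq_rhs[OF *])
         (use dg[OF i] in \<open>auto simp: has_derivative_def linear_simps algebra_simps\<close>)
  qed
  obtain b where b: "0 < b" "b < t" "?\<chi> t - ?\<chi> 0 = (t - 0) * ?D2 (x + a *\<^sub>R v + b *\<^sub>R w) w"
    using MVT2[of 0 t ?\<chi>, OF t(1) d2] by blast
  show thesis
  proof (rule that)
    show "dist (x + a *\<^sub>R v + b *\<^sub>R w) x \<le> t * (norm v + norm w)" using near a b by auto
    show "f (x + t *\<^sub>R v + t *\<^sub>R w) - f (x + t *\<^sub>R v) - f (x + t *\<^sub>R w) + f x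
      = t * (t * ?D2 (x + a *\<^sub>R v + b *\<^sub>R w) w)" using a(3) b(3) by simp
  qed
qed

text \<open>Schwarz's theorem. If the two mixed derivatives differed at \<open>x\<close>, then by continuity they would stay apart
on a small ball, whereas the second difference over a small parallelogram equals either of them at some
point of that ball.\<close>

lemma frechet_derivative_commute:
  fixes f :: "'a::euclidean_space \<Rightarrow> real"
  assumes S: "open S" "smooth_on S f" "x \<in> S"
  shows "frechet_derivative (\<lambda>y. frechet_derivative f (at y) v) (at x) w
       = frechet_derivative (\<lambda>y. frechet_derivative f (at y) w) (at x) v" (is "?P x = ?Q x")
proof (rule ccontr)
  assume ne: "?P x \<noteq> ?Q x"
  define \<epsilon> where "\<epsilon> = \<bar>?P x - ?Q x\<bar> / 2"
  have "\<epsilon> > 0" using ne by (simp add: \<epsilon>_def)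
  have "continuous_on S ?P" "continuous_on S ?Q"
    using S by (auto intro: smooth_on_continuous smooth_on_frechet)
  then have "isCont ?P x" "isCont ?Q x" using S by (auto simp: continuous_on_eq_continuous_at)
  then obtain d1 d2 where d: "d1 > 0" "d2 > 0"
     "\<And>z. dist z x < d1 \<Longrightarrow> dist (?P z) (?P x) < \<epsilon>" "\<And>z. dist z x < d2 \<Longrightarrow> dist (?Q z) (?Q x) < \<epsilon>"
    using \<open>\<epsilon> > 0\<close> unfolding continuous_at_eps_delta by metis
  obtain e where e: "e > 0" "ball x e \<subseteq> S" using S(1,3) open_contains_ball by blast
  define m where "m = min e (min d1 d2)"
  \<comment> \<open>The summand 1 covers the case \<open>v = w = 0\<close>.\<close>
  define t where "t = m / (norm v + norm w + 1)"
  have m: "m > 0" using d e by (simp add: m_def)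
  have n: "norm v + norm w + 1 > 0" by (simp add: add_nonneg_pos)
  have t: "t > 0" using m n by (simp add: t_def)
  have tm: "t * (norm v + norm w) < m"
  proof -
    have "t * (norm v + norm w) < t * (norm v + norm w + 1)" using t by simp
    also have "\<dots> = m" using n by (simp add: t_def)
    finally show ?thesis .
  qed
  then have te: "t * (norm v + norm w) < e" "t * (norm w + norm v) < e"
    by (auto simp: m_def add.commute)
  obtain z where z: "dist z x \<le> t * (norm v + norm w)"
    "f (x + t *\<^sub>R v + t *\<^sub>R w) - f (x + t *\<^sub>R v) - f (x + t *\<^sub>R w) + f x = t * (t * ?P z)"
    using second_difference_mvt[OF S(1,2) e(2) t te(1)] .
  obtain z' where z': "dist z' x \<le> t * (norm w + norm v)"
    "f (x + t *\<^sub>R w + t *\<^sub>R v) - f (x + t *\<^sub>R w) - f (x + t *\<^sub>R v) + f x = t * (t * ?Q z')"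
    using second_difference_mvt[OF S(1,2) e(2) t te(2)] .
  have "?P z = ?Q z'" using z(2) z'(2) t by (simp add: algebra_simps)
  moreover have "dist (?P z) (?P x) < \<epsilon>" "dist (?Q z') (?Q x) < \<epsilon>"
    using d z(1) z'(1) tm by (auto simp: m_def add.commute)
  ultimately show False unfolding \<epsilon>_def dist_real_def by argo
qed

lemma smooth_on_partial: "smooth_on S f \<Longrightarrow> smooth_on S (partial i f)"
  unfolding partial_def by (rule smooth_on_frechet)

lemma partial_commute:
  "open S \<Longrightarrow> smooth_on S f \<Longrightarrow> x \<in> S \<Longrightarrow> partial i (partial j f) x = partial j (partial i f) x"
  unfolding partial_def by (rule frechet_derivative_commute)

lemma partial_cong:
  assumes "open S" "x \<in> S" "smooth_on S f" "\<And>y. y \<in> S \<Longrightarrow> f y = g y"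
  shows "partial i f x = partial i g x"
  unfolding partial_def
  using frechet_derivative_transform_within_open[OF smooth_on_differentiable[OF assms(3,2)] assms(1,2,4)]
  by simp

lemma partial_const: "partial i (\<lambda>x. c) x = 0"
  by (simp add: partial_def)

lemma partial_nth: "partial i (\<lambda>x. x $ j) x = (if i = j then 1 else 0)"
  unfolding partial_def
  by (subst frechet_derivative_eqI[OF bounded_linear.has_derivative[OF bounded_linear_vec_nth has_derivative_ident]])
     (simp add: axis_def)

lemma partial_add:
  assumes "smooth_on S f" "smooth_on S g" "x \<in> S"
  shows "partial i (\<lambda>x. f x + g x) x = partial i f x + partial i g x"
  unfolding partial_def
  by (subst frechet_derivative_eqI[OF has_derivative_add])
     (auto simp: frechet_derivative_works[symmetric] intro: smooth_on_differentiable assms)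

lemma partial_diff:
  assumes "smooth_on S f" "smooth_on S g" "x \<in> S"
  shows "partial i (\<lambda>x. f x - g x) x = partial i f x - partial i g x"
  unfolding partial_def
  by (subst frechet_derivative_eqI[OF has_derivative_diff])
     (auto simp: frechet_derivative_works[symmetric] intro: smooth_on_differentiable assms)

lemma partial_mult:
  assumes "smooth_on S f" "smooth_on S g" "x \<in> S"
  shows "partial i (\<lambda>x. f x * g x) x = f x * partial i g x + partial i f x * g x"
  unfolding partial_def
  by (subst frechet_derivative_eqI[OF has_derivative_mult])
     (auto simp: frechet_derivative_works[symmetric] intro: smooth_on_differentiable assms)

lemma partial_sum:
  assumes "\<And>j. j \<in> I \<Longrightarrow> smooth_on S (f j)" "x \<in> S"
  shows "partial i (\<lambda>x. \<Sum>j\<in>I. f j x) x = (\<Sum>j\<in>I. partial i (f j) x)"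
  unfolding partial_def
  by (subst frechet_derivative_eqI[OF has_derivative_sum
        [where f' = "\<lambda>j. frechet_derivative (f j) (at x)"]])
     (auto simp: frechet_derivative_works[symmetric] intro: smooth_on_differentiable[OF assms(1)] assms(2))

lemma frechet_derivative_partials:
  assumes "f differentiable (at x)"
  shows "frechet_derivative f (at x) a = (\<Sum>i\<in>UNIV. a $ i * partial i f x)"
proof -
  have "linear (frechet_derivative f (at x))" using linear_frechet_derivative[OF assms] .
  then have "frechet_derivative f (at x) (\<Sum>i\<in>UNIV. a $ i *\<^sub>R axis i 1) = (\<Sum>i\<in>UNIV. a $ i * partial i f x)"
    by (simp add: linear_sum linear_scale partial_def)
  then show ?thesis using basis_expansion[of a] by (simp add: scalar_mult_eq_scaleR)
qed

lemma sum_swap_pairs: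
  "(\<Sum>a\<in>I. \<Sum>b\<in>I. \<Sum>i\<in>J. \<Sum>j\<in>J. F a b i j) = (\<Sum>i\<in>J. \<Sum>j\<in>J. \<Sum>a\<in>I. \<Sum>b\<in>I. F a b i j)"
proof -
  have "(\<Sum>a\<in>I. \<Sum>b\<in>I. \<Sum>i\<in>J. \<Sum>j\<in>J. F a b i j) = (\<Sum>a\<in>I. \<Sum>i\<in>J. \<Sum>j\<in>J. \<Sum>b\<in>I. F a b i j)"
    by (intro sum.cong refl, subst sum.swap, intro sum.cong refl, rule sum.swap)
  also have "\<dots> = (\<Sum>i\<in>J. \<Sum>j\<in>J. \<Sum>a\<in>I. \<Sum>b\<in>I. F a b i j)"
    by (subst sum.swap, intro sum.cong refl, rule sum.swap)
  finally show ?thesis .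
qed

section \<open>Two inequalities for quadratic forms and real numbers\<close>

text \<open>The trace of a product of two positive semidefinite matrices is nonnegative, one of them being taken
definite here. The induction removes one index \<open>k\<close> at a time: subtracting from \<open>H\<close> the rank-one matrix
\<open>b b\<^sup>T / H k k\<close>, with \<open>b\<close> the \<open>k\<close>-th column, leaves the Schur complement, whose \<open>k\<close>-th row and column
vanish and which is again positive definite on the other indices, while the rank-one part contributes
\<open>b\<^sup>T M b / H k k \<ge> 0\<close>.\<close>

lemma trace_prod_nonneg:
  fixes H M :: "'i \<Rightarrow> 'i \<Rightarrow> real"
  assumes "finite I"
    and "\<And>a. \<exists>i\<in>I. a i \<noteq> 0 \<Longrightarrow> (\<Sum>i\<in>I. \<Sum>j\<in>I. a i * a j * H i j) > 0"
    and "\<And>i j. i \<in> I \<Longrightarrow> j \<in> I \<Longrightarrow> H i j = H j i"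
    and "\<And>a. (\<Sum>i\<in>I. \<Sum>j\<in>I. a i * a j * M i j) \<ge> 0"
  shows "(\<Sum>i\<in>I. \<Sum>j\<in>I. H i j * M i j) \<ge> 0"
  using assms
proof (induction I arbitrary: H rule: finite_induct)
  case empty
  then show ?case by simp
next
  case (insert k I)
  note pos = insert.prems(1) and sym = insert.prems(2) and M = insert.prems(3)
  have split: "(\<Sum>i\<in>insert k I. \<Sum>j\<in>insert k I. F i j)
      = F k k + (\<Sum>j\<in>I. F k j) + (\<Sum>i\<in>I. F i k) + (\<Sum>i\<in>I. \<Sum>j\<in>I. F i j)" for F :: "'i \<Rightarrow> 'i \<Rightarrow> real"
    using insert.hyps by (simp add: sum.distrib)
  have notk: "i \<noteq> k" if "i \<in> I" for i using that insert.hyps by auto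
  have kk: "H k k > 0"
    using pos[of "\<lambda>i. if i = k then 1 else 0"] unfolding split
    by (simp add: notk cong: sum.cong)
  define b where "b i = H i k" for i
  define H' where "H' i j = H i j - b i * b j / H k k" for i j
  have "(\<Sum>i\<in>I. \<Sum>j\<in>I. a i * a j * H' i j) > 0" if "\<exists>i\<in>I. a i \<noteq> 0" for a
  proof -
    define s where "s = (\<Sum>i\<in>I. a i * b i)"
    \<comment> \<open>The value at \<open>k\<close> minimises the form \<open>H\<close> among all extensions of \<open>a\<close>; the minimum is the Schur complement.\<close>
    define a' where "a' i = (if i = k then - s / H k k else a i)" for i
    have "\<exists>i\<in>insert k I. a' i \<noteq> 0" using that notk by (auto simp: a'_def)
    from pos[OF this] have "0 < a' k * a' k * H k k + (\<Sum>j\<in>I. a' k * a' j * H k j)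
        + (\<Sum>i\<in>I. a' i * a' k * H i k) + (\<Sum>i\<in>I. \<Sum>j\<in>I. a' i * a' j * H i j)"
      unfolding split .
    also have "(\<Sum>j\<in>I. a' k * a' j * H k j) = a' k * s"
      unfolding s_def sum_distrib_left by (rule sum.cong) (auto simp: a'_def notk b_def sym)
    also have "(\<Sum>i\<in>I. a' i * a' k * H i k) = a' k * s"
      unfolding s_def sum_distrib_left by (rule sum.cong) (auto simp: a'_def notk b_def)
    also have "(\<Sum>i\<in>I. \<Sum>j\<in>I. a' i * a' j * H i j) = (\<Sum>i\<in>I. \<Sum>j\<in>I. a i * a j * H i j)"
      by (intro sum.cong refl) (auto simp: a'_def notk)
    also have "a' k * a' k * H k k + a' k * s + a' k * s = - (s * s / H k k)"
      using kk by (simp add: a'_def field_simps)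
    also have "s * s / H k k = (\<Sum>i\<in>I. \<Sum>j\<in>I. a i * a j * (b i * b j / H k k))"
      unfolding s_def sum_product sum_divide_distrib by (intro sum.cong refl) (simp add: mult_ac)
    finally show ?thesis by (simp add: H'_def right_diff_distrib sum_subtractf)
  qed
  moreover have "H' i j = H' j i" if "i \<in> I" "j \<in> I" for i j
    using sym that by (simp add: H'_def mult.commute)
  moreover have "(\<Sum>i\<in>I. \<Sum>j\<in>I. a i * a j * M i j) \<ge> 0" for a
  proof -
    have "(\<Sum>i\<in>I. \<Sum>j\<in>I. a i * a j * M i j)
        = (\<Sum>i\<in>I. \<Sum>j\<in>I. (a(k := 0)) i * (a(k := 0)) j * M i j)"
      by (intro sum.cong refl) (auto simp: notk)
    also have "\<dots> = (\<Sum>i\<in>insert k I. \<Sum>j\<in>insert k I. (a(k := 0)) i * (a(k := 0)) j * M i j)"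
      unfolding split by simp
    finally show ?thesis using M by simp
  qed
  ultimately have IH: "(\<Sum>i\<in>I. \<Sum>j\<in>I. H' i j * M i j) \<ge> 0" by (rule insert.IH)
  have row: "H' k i = 0" "H' i k = 0" if "i \<in> insert k I" for i
    using kk sym[OF that, of k] by (auto simp: H'_def b_def)
  have "(\<Sum>i\<in>insert k I. \<Sum>j\<in>insert k I. H i j * M i j)
     = (\<Sum>i\<in>insert k I. \<Sum>j\<in>insert k I. H' i j * M i j)
       + (\<Sum>i\<in>insert k I. \<Sum>j\<in>insert k I. b i * b j * M i j) / H k k"
    unfolding sum_divide_distrib sum.distrib[symmetric]
    by (intro sum.cong refl) (simp add: H'_def field_simps)
  also have "(\<Sum>i\<in>insert k I. \<Sum>j\<in>insert k I. H' i j * M i j) = (\<Sum>i\<in>I. \<Sum>j\<in>I. H' i j * M i j)"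
    unfolding split by (simp add: row)
  finally show ?case using IH M[of b] kk by simp
qed

text \<open>With \<open>m = - N > 0\<close> this is the Cauchy--Schwarz inequality \<open>t\<^sup>2 / n + (t - b)\<^sup>2 / m \<ge> b\<^sup>2 / (n + m)\<close> for the
difference \<open>b = t - (t - b)\<close>; the gap between the two sides is a square over a positive number.\<close>

lemma weighted_square_ineq:
  fixes t b n N :: real
  assumes "n > 0" "N < 0"
  shows "t\<^sup>2 / n \<ge> - (b\<^sup>2 / (N - n)) + (t - b)\<^sup>2 / N"
proof -
  have N: "n - N > 0" using assms by simp
  have "t\<^sup>2 / n - (- (b\<^sup>2 / (N - n)) + (t - b)\<^sup>2 / N) = (N * t - n * (t - b))\<^sup>2 / (n * (- N) * (n - N))"
    using assms N by (simp add: divide_simps) (simp add: power2_eq_square algebra_simps)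
  also have "\<dots> \<ge> 0" using assms N by (intro divide_nonneg_nonneg mult_nonneg_nonneg) auto
  finally show ?thesis by simp
qed

section \<open>Tensor calculus in a coordinate patch\<close>

definition grad_coeff ::
    "('a, 'n::finite) riem_manifold \<Rightarrow> ('a, 'n) chart \<Rightarrow> ('a \<Rightarrow> real) \<Rightarrow> 'n \<Rightarrow> real^'n \<Rightarrow> real" where
  "grad_coeff M c f i x =
     (\<Sum>k\<in>UNIV. inv_metric_coeff M c x $ i $ k * partial k (f \<circ> chart_inv c) x)"

definition grad_prod_coeff ::
    "('a, 'n::finite) riem_manifold \<Rightarrow> ('a, 'n) chart \<Rightarrow> ('a \<Rightarrow> real) \<Rightarrow> ('a \<Rightarrow> real) \<Rightarrow> real^'n \<Rightarrow> real"
  where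
  "grad_prod_coeff M c f h x = (\<Sum>k\<in>UNIV. grad_coeff M c f k x * partial k (h \<circ> chart_inv c) x)"

text \<open>The components of the endomorphism \<open>v \<mapsto> \<nabla>\<^sub>v \<nabla>f\<close>: the Hessian with one index raised.\<close>
definition hess_endo ::
    "('a, 'n::finite) riem_manifold \<Rightarrow> ('a, 'n) chart \<Rightarrow> ('a \<Rightarrow> real) \<Rightarrow> 'n \<Rightarrow> 'n \<Rightarrow> real^'n \<Rightarrow> real"
  where
  "hess_endo M c f i j x =
     (\<Sum>k\<in>UNIV. inv_metric_coeff M c x $ i $ k * hess_coeff M c f j k x)"

definition laplace_coeff ::
    "('a, 'n::finite) riem_manifold \<Rightarrow> ('a, 'n) chart \<Rightarrow> ('a \<Rightarrow> real) \<Rightarrow> real^'n \<Rightarrow> real" where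
  "laplace_coeff M c f x =
     (\<Sum>i\<in>UNIV. \<Sum>j\<in>UNIV. inv_metric_coeff M c x $ i $ j * hess_coeff M c f i j x)"

lemmas smooth_on_intros = smooth_on_const smooth_on_add smooth_on_mult smooth_on_diff smooth_on_sum
  smooth_on_partial

text \<open>All calculations in coordinates use only that the metric coefficients are smooth, symmetric and positive
definite on an open set of \<open>\<real>\<^sup>n\<close>.\<close>

locale metric_patch =
  fixes M :: "('a, 'n::finite) riem_manifold" and c :: "('a, 'n) chart" and S :: "(real^'n) set"
  assumes open_S: "open S"
    and smooth_G: "smooth_on S (\<lambda>x. metric_coeff M c x $ i $ j)"
    and G_sym: "x \<in> S \<Longrightarrow> metric_coeff M c x $ i $ j = metric_coeff M c x $ j $ i"
    and G_pos: "x \<in> S \<Longrightarrow> a \<noteq> 0 \<Longrightarrow>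
      (\<Sum>i\<in>UNIV. \<Sum>j\<in>UNIV. a $ i * a $ j * metric_coeff M c x $ i $ j) > 0"
begin

abbreviation G where "G i j \<equiv> \<lambda>x. metric_coeff M c x $ i $ j"
abbreviation H where "H i j \<equiv> \<lambda>x. inv_metric_coeff M c x $ i $ j"
abbreviation \<Gamma> where "\<Gamma> k i j \<equiv> christoffel M c k i j"
abbreviation X where "X f i \<equiv> grad_coeff M c f i"
abbreviation hess where "hess f i j \<equiv> hess_coeff M c f i j"
abbreviation A where "A f i j \<equiv> hess_endo M c f i j"
abbreviation pull where "pull f \<equiv> f \<circ> chart_inv c"

lemma invertible_G:
  assumes "x \<in> S" shows "invertible (metric_coeff M c x)"
proof -
  have "a = 0" if "metric_coeff M c x *v a = 0" for a
  proof (rule ccontr)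
    assume "a \<noteq> 0"
    from G_pos[OF assms this] have "0 < (\<Sum>i\<in>UNIV. a $ i * (metric_coeff M c x *v a) $ i)"
      by (simp add: matrix_vector_mult_def sum_distrib_left algebra_simps)
    then show False using that by simp
  qed
  then show ?thesis
    by (auto simp: invertible_left_inverse matrix_left_invertible_ker)
qed

lemma inverse_G:
  assumes "x \<in> S"
  shows "metric_coeff M c x ** inv_metric_coeff M c x = mat 1"
    "inv_metric_coeff M c x ** metric_coeff M c x = mat 1"
  using invertible_G[OF assms] unfolding invertible_def inv_metric_coeff_def matrix_inv_def
  by (metis (mono_tags, lifting) someI_ex)+

lemma GH: "x \<in> S \<Longrightarrow> (\<Sum>k\<in>UNIV. G i k x * H k j x) = (if i = j then 1 else 0)"
  using arg_cong[OF inverse_G(1)[of x], of "\<lambda>B. B $ i $ j"]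
  by (simp add: matrix_matrix_mult_def mat_def)

lemma HG: "x \<in> S \<Longrightarrow> (\<Sum>k\<in>UNIV. H i k x * G k j x) = (if i = j then 1 else 0)"
  using arg_cong[OF inverse_G(2)[of x], of "\<lambda>B. B $ i $ j"]
  by (simp add: matrix_matrix_mult_def mat_def)

lemma GH_apply: "x \<in> S \<Longrightarrow> (\<Sum>k\<in>UNIV. G i k x * (\<Sum>l\<in>UNIV. H k l x * q l)) = q i"
proof -
  assume x: "x \<in> S"
  have "(\<Sum>k\<in>UNIV. G i k x * (\<Sum>l\<in>UNIV. H k l x * q l)) = (\<Sum>l\<in>UNIV. (\<Sum>k\<in>UNIV. G i k x * H k l x) * q l)"
    by (subst sum_distrib_right, subst sum.swap) (simp add: sum_distrib_left algebra_simps)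
  then show ?thesis by (simp add: GH[OF x] if_distrib[of "\<lambda>t. t * _"] cong: if_cong)
qed

lemma HG_apply: "x \<in> S \<Longrightarrow> (\<Sum>k\<in>UNIV. H i k x * (\<Sum>l\<in>UNIV. G k l x * q l)) = q i"
proof -
  assume x: "x \<in> S"
  have "(\<Sum>k\<in>UNIV. H i k x * (\<Sum>l\<in>UNIV. G k l x * q l)) = (\<Sum>l\<in>UNIV. (\<Sum>k\<in>UNIV. H i k x * G k l x) * q l)"
    by (subst sum_distrib_right, subst sum.swap) (simp add: sum_distrib_left algebra_simps)
  then show ?thesis by (simp add: HG[OF x] if_distrib[of "\<lambda>t. t * _"] cong: if_cong)
qed

lemma H_sym:
  assumes x: "x \<in> S" shows "H i j x = H j i x"
proof -
  have "(\<Sum>l\<in>UNIV. G k l x * H i l x) = (if i = k then 1 else 0)" for k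
    using HG[OF x, of i k] by (simp add: G_sym[OF x, of k] mult.commute)
  then have "(\<Sum>k\<in>UNIV. H j k x * (\<Sum>l\<in>UNIV. G k l x * H i l x)) = H j i x"
    by (simp add: if_distrib[of "\<lambda>t. _ * t"] cong: if_cong)
  then show ?thesis by (simp only: HG_apply[OF x])
qed

lemma H_pos:
  assumes x: "x \<in> S" and "w \<noteq> (\<lambda>i. 0)"
  shows "(\<Sum>i\<in>UNIV. \<Sum>j\<in>UNIV. w i * w j * H i j x) > 0"
proof -
  define a :: "real^'n" where "a = (\<chi> i. \<Sum>j\<in>UNIV. H i j x * w j)"
  have Ga: "(\<Sum>j\<in>UNIV. G i j x * a $ j) = w i" for i
    unfolding a_def by (simp add: GH_apply[OF x])
  have "a \<noteq> 0" using Ga assms(2) by auto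
  from G_pos[OF x this] have "0 < (\<Sum>i\<in>UNIV. a $ i * (\<Sum>j\<in>UNIV. G i j x * a $ j))"
    by (simp add: sum_distrib_left algebra_simps)
  then have "0 < (\<Sum>i\<in>UNIV. a $ i * w i)" by (simp add: Ga)
  then show ?thesis unfolding a_def by (simp add: sum_distrib_left sum_distrib_right algebra_simps)
qed

text \<open>Cramer's rule exhibits the inverse metric as a quotient of polynomials in the metric coefficients.\<close>

lemma smooth_H: "smooth_on S (H i j)"
proof (rule smooth_on_cong[OF open_S])
  fix x assume x: "x \<in> S"
  have "det (metric_coeff M c x) \<noteq> 0" using invertible_G[OF x] by (simp add: invertible_det_nz)
  moreover have "metric_coeff M c x *v column j (inv_metric_coeff M c x) = axis j 1"
    by (simp add: vec_eq_iff matrix_vector_mult_def column_def GH[OF x] axis_def eq_commute)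
  ultimately have "column j (inv_metric_coeff M c x) =
    (\<chi> k. det (\<chi> a b. if b = k then axis j 1 $ a else G a b x) / det (metric_coeff M c x))"
    by (rule cramer[THEN iffD1])
  from arg_cong[OF this, of "\<lambda>v. v $ i"]
  show "det (\<chi> a b. if b = i then axis j 1 $ a else G a b x) / det (metric_coeff M c x) = H i j x"
    by (simp add: column_def)
next
  have "smooth_on S (\<lambda>x. (\<chi> a b. if b = i then axis j 1 $ a else G a b x) $ k $ l)" for k l
    by (cases "l = i") (auto intro: smooth_on_const smooth_G)
  then show "smooth_on S (\<lambda>x. det (\<chi> a b. if b = i then axis j 1 $ a else G a b x) / det (metric_coeff M c x))"
    by (intro smooth_on_divide smooth_on_det open_S smooth_G)
       (use invertible_G in \<open>auto simp: invertible_det_nz\<close>)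
qed

lemma smooth_\<Gamma>: "smooth_on S (\<Gamma> k i j)"
proof -
  have "smooth_on S (\<lambda>x. (\<Sum>l\<in>UNIV. H k l x * (partial i (G j l) x + partial j (G i l) x
      - partial l (G i j) x)) * (1/2))"
    by (intro smooth_on_intros smooth_H smooth_G open_S)
  then show ?thesis by (rule smooth_on_cong[OF open_S, rotated]) (simp add: christoffel_def)
qed

lemma smooth_grad: "smooth_on S (pull f) \<Longrightarrow> smooth_on S (X f i)"
  unfolding grad_coeff_def by (intro smooth_on_intros smooth_H open_S)

lemma smooth_grad_prod:
  "smooth_on S (pull f) \<Longrightarrow> smooth_on S (pull h) \<Longrightarrow> smooth_on S (grad_prod_coeff M c f h)"
  unfolding grad_prod_coeff_def by (intro smooth_on_intros smooth_grad open_S)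

lemma smooth_hess: "smooth_on S (pull f) \<Longrightarrow> smooth_on S (hess f i j)"
  unfolding hess_coeff_def by (intro smooth_on_intros smooth_\<Gamma> open_S)

lemma smooth_hess_endo: "smooth_on S (pull f) \<Longrightarrow> smooth_on S (A f i j)"
  unfolding hess_endo_def by (intro smooth_on_intros smooth_H smooth_hess open_S)

lemma smooth_laplace: "smooth_on S (pull f) \<Longrightarrow> smooth_on S (laplace_coeff M c f)"
  unfolding laplace_coeff_def by (intro smooth_on_intros smooth_H smooth_hess open_S)

lemma partial_G_sym: "x \<in> S \<Longrightarrow> partial k (G i j) x = partial k (G j i) x"
  by (rule partial_cong[OF open_S _ smooth_G G_sym])

lemma \<Gamma>_sym: "x \<in> S \<Longrightarrow> \<Gamma> k i j x = \<Gamma> k j i x"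
  unfolding christoffel_def by (simp add: partial_G_sym[of x _ i j] add.commute)

lemma hess_sym: "x \<in> S \<Longrightarrow> smooth_on S (pull f) \<Longrightarrow> hess f i j x = hess f j i x"
  unfolding hess_coeff_def by (simp add: partial_commute[OF open_S] \<Gamma>_sym[of x _ i j])

text \<open>Lowering the upper index of \<open>\<Gamma>\<close> cancels the inverse metric in its definition and leaves the Christoffel
symbols of the first kind.\<close>

lemma lower_\<Gamma>:
  assumes x: "x \<in> S"
  shows "(\<Sum>k\<in>UNIV. G b k x * \<Gamma> k i j x)
    = (partial i (G j b) x + partial j (G i b) x - partial b (G i j) x) / 2"
proof -
  have "(\<Sum>k\<in>UNIV. G b k x * \<Gamma> k i j x) =
    (\<Sum>k\<in>UNIV. G b k x * (\<Sum>l\<in>UNIV. H k l x *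
      (partial i (G j l) x + partial j (G i l) x - partial l (G i j) x))) / 2"
    unfolding christoffel_def times_divide_eq_right sum_divide_distrib[symmetric] ..
  then show ?thesis by (simp only: GH_apply[OF x])
qed

text \<open>Metric compatibility \<open>\<nabla>g = 0\<close> of the connection: the derivatives that \<open>lower_\<Gamma>\<close> produces cancel in pairs.\<close>

lemma partial_G:
  assumes x: "x \<in> S"
  shows "partial j (G a b) x = (\<Sum>m\<in>UNIV. G b m x * \<Gamma> m j a x) + (\<Sum>m\<in>UNIV. G a m x * \<Gamma> m j b x)"
  unfolding lower_\<Gamma>[OF x]
  using partial_G_sym[OF x, of j b a] partial_G_sym[OF x, of a j b] partial_G_sym[OF x, of b j a]
  by (simp add: field_simps)

text \<open>Metric compatibility for the inverse metric, obtained by differentiating \<open>G H = 1\<close>.\<close>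

lemma partial_H:
  assumes x: "x \<in> S"
  shows "partial j (H i k) x = - (\<Sum>a\<in>UNIV. H i a x * \<Gamma> k j a x) - (\<Sum>b\<in>UNIV. \<Gamma> i j b x * H b k x)"
proof -
  have *: "(\<Sum>b\<in>UNIV. G a b x * partial j (H b k) x) = - \<Gamma> k j a x - (\<Sum>m\<in>UNIV. G a m x * (\<Sum>b\<in>UNIV. \<Gamma> m j b x * H b k x))"
    for a
  proof -
    have "partial j (\<lambda>x. \<Sum>b\<in>UNIV. G a b x * H b k x) x = partial j (\<lambda>x. if a = k then 1 else 0) x"
      by (rule partial_cong[OF open_S x]) (intro smooth_on_intros smooth_H smooth_G open_S, rule GH)
    also have "\<dots> = 0" by (rule partial_const)
    finally have "0 = partial j (\<lambda>x. \<Sum>b\<in>UNIV. G a b x * H b k x) x" by simp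
    also have "\<dots> = (\<Sum>b\<in>UNIV. partial j (\<lambda>x. G a b x * H b k x) x)"
      by (rule partial_sum[OF _ x]) (intro smooth_on_intros smooth_H smooth_G open_S)
    also have "\<dots> = (\<Sum>b\<in>UNIV. G a b x * partial j (H b k) x + partial j (G a b) x * H b k x)"
      by (intro sum.cong refl partial_mult[OF smooth_G smooth_H x])
    also have "\<dots> = (\<Sum>b\<in>UNIV. G a b x * partial j (H b k) x) +
        (\<Sum>b\<in>UNIV. H k b x * (\<Sum>m\<in>UNIV. G b m x * \<Gamma> m j a x)) +
        (\<Sum>b\<in>UNIV. \<Sum>m\<in>UNIV. G a m x * \<Gamma> m j b x * H b k x)"
      by (simp add: partial_G[OF x] H_sym[OF x, of k] sum.distrib sum_distrib_right sum_distrib_left algebra_simps)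
    also have "\<dots> = (\<Sum>b\<in>UNIV. G a b x * partial j (H b k) x) + \<Gamma> k j a x +
        (\<Sum>m\<in>UNIV. G a m x * (\<Sum>b\<in>UNIV. \<Gamma> m j b x * H b k x))"
      unfolding HG_apply[OF x] by (subst sum.swap) (simp add: sum_distrib_left algebra_simps)
    finally show ?thesis by simp
  qed
  have "partial j (H i k) x = (\<Sum>a\<in>UNIV. H i a x * (\<Sum>b\<in>UNIV. G a b x * partial j (H b k) x))"
    by (simp add: HG_apply[OF x])
  also have "\<dots> = (\<Sum>a\<in>UNIV. H i a x * (- \<Gamma> k j a x))
      - (\<Sum>a\<in>UNIV. H i a x * (\<Sum>m\<in>UNIV. G a m x * (\<Sum>b\<in>UNIV. \<Gamma> m j b x * H b k x)))"
    unfolding * by (simp add: sum_subtractf right_diff_distrib sum_negf)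
  finally show ?thesis unfolding HG_apply[OF x] by (simp add: sum_negf)
qed

text \<open>Since \<open>\<nabla>g = 0\<close>, raising an index commutes with covariant differentiation, so \<open>\<nabla>\<^sub>j X\<^sup>i = A\<^sup>i\<^sub>j\<close> for the
gradient field \<open>X\<close>. This allows every derivative of a gradient to be traded for the Hessian.\<close>

lemma partial_grad:
  assumes x: "x \<in> S" and f: "smooth_on S (pull f)"
  shows "partial j (X f i) x = A f i j x - (\<Sum>l\<in>UNIV. \<Gamma> i j l x * X f l x)"
proof -
  have "partial j (X f i) x = (\<Sum>k\<in>UNIV. partial j (\<lambda>x. H i k x * partial k (pull f) x) x)"
    unfolding grad_coeff_def by (rule partial_sum[OF _ x]) (intro smooth_on_intros smooth_H open_S f)
  also have "\<dots> = (\<Sum>k\<in>UNIV. H i k x * partial j (partial k (pull f)) x + partial j (H i k) x * partial k (pull f) x)"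
    by (intro sum.cong refl partial_mult[OF smooth_H _ x] smooth_on_partial f)
  also have "\<dots> = (\<Sum>k\<in>UNIV. H i k x * partial j (partial k (pull f)) x)
     - (\<Sum>k\<in>UNIV. \<Sum>a\<in>UNIV. H i a x * \<Gamma> k j a x * partial k (pull f) x)
     - (\<Sum>k\<in>UNIV. \<Sum>b\<in>UNIV. \<Gamma> i j b x * H b k x * partial k (pull f) x)"
    by (simp add: partial_H[OF x] sum.distrib sum_subtractf sum_distrib_right sum_distrib_left sum_negf
        algebra_simps)
  also have "(\<Sum>k\<in>UNIV. \<Sum>a\<in>UNIV. H i a x * \<Gamma> k j a x * partial k (pull f) x)
     = (\<Sum>a\<in>UNIV. H i a x * (\<Sum>k\<in>UNIV. \<Gamma> k j a x * partial k (pull f) x))"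
    by (subst sum.swap) (simp add: sum_distrib_left algebra_simps)
  also have "(\<Sum>k\<in>UNIV. \<Sum>b\<in>UNIV. \<Gamma> i j b x * H b k x * partial k (pull f) x) = (\<Sum>l\<in>UNIV. \<Gamma> i j l x * X f l x)"
    unfolding grad_coeff_def by (subst sum.swap) (simp add: sum_distrib_left algebra_simps)
  also have "(\<Sum>k\<in>UNIV. H i k x * partial j (partial k (pull f)) x)
     - (\<Sum>a\<in>UNIV. H i a x * (\<Sum>k\<in>UNIV. \<Gamma> k j a x * partial k (pull f) x)) = A f i j x"
    unfolding hess_endo_def hess_coeff_def by (simp add: sum_subtractf right_diff_distrib)
  finally show ?thesis .
qed

lemma hess_endo_contract:
  assumes x: "x \<in> S"
  shows "(\<Sum>k\<in>UNIV. A f k j x * partial k (pull h) x) = (\<Sum>a\<in>UNIV. hess f j a x * X h a x)"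
  unfolding hess_endo_def grad_coeff_def sum_distrib_right sum_distrib_left
  by (subst sum.swap, intro sum.cong refl) (simp add: H_sym[OF x] mult_ac)

text \<open>The Leibniz rule \<open>d\<langle>\<nabla>f, \<nabla>h\<rangle> = Hess f(\<sqdot>, \<nabla>h) + Hess h(\<sqdot>, \<nabla>f)\<close>; the Christoffel terms coming from the two
factors cancel.\<close>

lemma partial_grad_prod:
  assumes x: "x \<in> S" and f: "smooth_on S (pull f)" and h: "smooth_on S (pull h)"
  shows "partial j (grad_prod_coeff M c f h) x
    = (\<Sum>a\<in>UNIV. hess f j a x * X h a x) + (\<Sum>a\<in>UNIV. hess h j a x * X f a x)"
proof -
  have "partial j (grad_prod_coeff M c f h) x = (\<Sum>k\<in>UNIV. partial j (\<lambda>x. X f k x * partial k (pull h) x) x)"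
    unfolding grad_prod_coeff_def
    by (rule partial_sum[OF _ x]) (intro smooth_on_intros smooth_grad open_S f h)
  also have "\<dots> = (\<Sum>k\<in>UNIV. X f k x * partial j (partial k (pull h)) x + partial j (X f k) x * partial k (pull h) x)"
    by (intro sum.cong refl partial_mult[OF _ _ x] smooth_on_partial smooth_grad f h)
  also have "\<dots> = (\<Sum>k\<in>UNIV. X f k x * partial j (partial k (pull h)) x)
     + (\<Sum>k\<in>UNIV. A f k j x * partial k (pull h) x)
     - (\<Sum>k\<in>UNIV. \<Sum>l\<in>UNIV. \<Gamma> k j l x * X f l x * partial k (pull h) x)"
    by (simp add: partial_grad[OF x f] sum.distrib sum_subtractf sum_distrib_right left_diff_distrib)
  also have "(\<Sum>k\<in>UNIV. \<Sum>l\<in>UNIV. \<Gamma> k j l x * X f l x * partial k (pull h) x)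
     = (\<Sum>l\<in>UNIV. X f l x * (\<Sum>k\<in>UNIV. \<Gamma> k j l x * partial k (pull h) x))"
    by (subst sum.swap) (simp add: sum_distrib_left mult_ac)
  also have "(\<Sum>k\<in>UNIV. A f k j x * partial k (pull h) x) = (\<Sum>a\<in>UNIV. hess f j a x * X h a x)"
    by (rule hess_endo_contract[OF x])
  finally show ?thesis
    by (simp add: hess_coeff_def[of M c h] sum_subtractf algebra_simps del: o_apply)
qed

lemma laplace_eq_trace: "laplace_coeff M c f x = (\<Sum>i\<in>UNIV. A f i i x)"
  unfolding laplace_coeff_def hess_endo_def by simp

lemma laplace_eq_div:
  assumes "x \<in> S" "smooth_on S (pull f)"
  shows "laplace_coeff M c f x = (\<Sum>i\<in>UNIV. partial i (X f i) x) + (\<Sum>i\<in>UNIV. \<Sum>l\<in>UNIV. \<Gamma> i i l x * X f l x)"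
  by (simp add: laplace_eq_trace partial_grad[OF assms] sum.distrib sum_subtractf)

text \<open>The commutation rule \<open>\<nabla>\<^sub>i \<nabla>\<^sub>k X\<^sup>i - \<nabla>\<^sub>k \<nabla>\<^sub>i X\<^sup>i = Ric\<^sub>k\<^sub>l X\<^sup>l\<close>, written with partial instead of covariant derivatives
of \<open>A = \<nabla>X\<close>, which accounts for the terms with \<open>\<Gamma>\<close> on the right. The second derivatives of \<open>X\<close> cancel by
Schwarz's theorem; the derivatives and the products of Christoffel symbols that remain are exactly those in
the definition of the Ricci tensor. This is the only place where curvature enters.\<close>

lemma contracted_ricci_identity:
  assumes x: "x \<in> S" and f: "smooth_on S (pull f)"
  shows "(\<Sum>i\<in>UNIV. partial i (A f i k) x - partial k (A f i i) x) =
    (\<Sum>l\<in>UNIV. ricci_coeff M c k l x * X f l x)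
    + (\<Sum>i\<in>UNIV. \<Sum>l\<in>UNIV. \<Gamma> i k l x * A f l i x - \<Gamma> i i l x * A f l k x)"
proof -
  have pA: "partial m (A f i j) x = partial m (partial j (X f i)) x
      + (\<Sum>l\<in>UNIV. \<Gamma> i j l x * partial m (X f l) x + partial m (\<Gamma> i j l) x * X f l x)" for m i j
  proof -
    have "partial m (A f i j) x = partial m (\<lambda>x. partial j (X f i) x + (\<Sum>l\<in>UNIV. \<Gamma> i j l x * X f l x)) x"
      by (rule partial_cong[OF open_S x smooth_hess_endo[OF f]]) (simp add: partial_grad[OF _ f])
    also have "\<dots> = partial m (partial j (X f i)) x + partial m (\<lambda>x. \<Sum>l\<in>UNIV. \<Gamma> i j l x * X f l x) x"
      by (rule partial_add[OF _ _ x]) (intro smooth_on_intros smooth_\<Gamma> smooth_grad open_S f)+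
    also have "partial m (\<lambda>x. \<Sum>l\<in>UNIV. \<Gamma> i j l x * X f l x) x = (\<Sum>l\<in>UNIV. partial m (\<lambda>x. \<Gamma> i j l x * X f l x) x)"
      by (rule partial_sum[OF _ x]) (intro smooth_on_intros smooth_\<Gamma> smooth_grad open_S f)
    also have "\<dots> = (\<Sum>l\<in>UNIV. \<Gamma> i j l x * partial m (X f l) x + partial m (\<Gamma> i j l) x * X f l x)"
      by (intro sum.cong refl partial_mult[OF smooth_\<Gamma> smooth_grad[OF f] x])
    finally show ?thesis .
  qed
  have "(\<Sum>i\<in>UNIV. partial i (A f i k) x - partial k (A f i i) x) =
    (\<Sum>i\<in>UNIV. \<Sum>l\<in>UNIV. (partial i (\<Gamma> i k l) x - partial k (\<Gamma> i i l) x) * X f l x)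
    + (\<Sum>i\<in>UNIV. \<Sum>l\<in>UNIV. \<Gamma> i k l x * A f l i x - \<Gamma> i i l x * A f l k x)
    + (\<Sum>i\<in>UNIV. \<Sum>l\<in>UNIV. \<Gamma> i i l x * (\<Sum>m\<in>UNIV. \<Gamma> l k m x * X f m x)
        - \<Gamma> i k l x * (\<Sum>m\<in>UNIV. \<Gamma> l i m x * X f m x))"
    by (simp add: pA partial_commute[OF open_S smooth_grad[OF f] x] partial_grad[OF x f]
        sum.distrib[symmetric] sum_subtractf[symmetric])
       (intro sum.cong refl, simp add: algebra_simps)
  also have "(\<Sum>i\<in>UNIV. \<Sum>l\<in>UNIV. \<Gamma> i i l x * (\<Sum>m\<in>UNIV. \<Gamma> l k m x * X f m x)
        - \<Gamma> i k l x * (\<Sum>m\<in>UNIV. \<Gamma> l i m x * X f m x))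
     = (\<Sum>i\<in>UNIV. \<Sum>m\<in>UNIV. (\<Sum>l\<in>UNIV. \<Gamma> l k m x * \<Gamma> i i l x - \<Gamma> l i m x * \<Gamma> i k l x) * X f m x)"
  proof (rule sum.cong[OF refl])
    fix i
    show "(\<Sum>l\<in>UNIV. \<Gamma> i i l x * (\<Sum>m\<in>UNIV. \<Gamma> l k m x * X f m x)
        - \<Gamma> i k l x * (\<Sum>m\<in>UNIV. \<Gamma> l i m x * X f m x))
     = (\<Sum>m\<in>UNIV. (\<Sum>l\<in>UNIV. \<Gamma> l k m x * \<Gamma> i i l x - \<Gamma> l i m x * \<Gamma> i k l x) * X f m x)"
      unfolding sum_distrib_left sum_distrib_right sum_subtractf[symmetric]
      by (subst sum.swap) (simp add: algebra_simps)
  qed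
  also have "(\<Sum>i\<in>UNIV. \<Sum>l\<in>UNIV. (partial i (\<Gamma> i k l) x - partial k (\<Gamma> i i l) x) * X f l x)
    + (\<Sum>i\<in>UNIV. \<Sum>l\<in>UNIV. \<Gamma> i k l x * A f l i x - \<Gamma> i i l x * A f l k x)
    + (\<Sum>i\<in>UNIV. \<Sum>m\<in>UNIV. (\<Sum>l\<in>UNIV. \<Gamma> l k m x * \<Gamma> i i l x - \<Gamma> l i m x * \<Gamma> i k l x) * X f m x)
    = (\<Sum>i\<in>UNIV. \<Sum>l\<in>UNIV. riemann_coeff M c i i k l x * X f l x)
    + (\<Sum>i\<in>UNIV. \<Sum>l\<in>UNIV. \<Gamma> i k l x * A f l i x - \<Gamma> i i l x * A f l k x)"
    unfolding riemann_coeff_def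
    by (simp add: sum.distrib sum_subtractf sum_distrib_left sum_distrib_right algebra_simps)
  also have "(\<Sum>i\<in>UNIV. \<Sum>l\<in>UNIV. riemann_coeff M c i i k l x * X f l x) = (\<Sum>l\<in>UNIV. ricci_coeff M c k l x * X f l x)"
    unfolding ricci_coeff_def by (subst sum.swap) (simp add: sum_distrib_right)
  finally show ?thesis .
qed

text \<open>The gradient of \<open>e = |\<nabla>u|\<^sup>2 / 2\<close> is \<open>A X\<close> with \<open>X = \<nabla>u\<close>, so \<open>\<Delta>e\<close> is the divergence of \<open>A X\<close>. In that divergence
the derivative falls on \<open>X\<close>, giving \<open>tr (A\<^sup>2)\<close>, or on \<open>A\<close>, giving the derivative of \<open>tr A = \<Delta>u\<close> and the
curvature by the contracted Ricci identity.\<close>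

lemma bochner:
  assumes x: "x \<in> S" and u: "smooth_on S (pull u)"
    and E: "\<And>y. y \<in> S \<Longrightarrow> pull e y = grad_prod_coeff M c u u y / 2"
  shows "laplace_coeff M c e x = (\<Sum>k\<in>UNIV. X u k x * partial k (laplace_coeff M c u) x)
    + (\<Sum>k\<in>UNIV. \<Sum>l\<in>UNIV. ricci_coeff M c k l x * X u k x * X u l x)
    + (\<Sum>i\<in>UNIV. \<Sum>k\<in>UNIV. A u i k x * A u k i x)"
proof -
  let ?q = "\<lambda>y. grad_prod_coeff M c u u y * (1/2)"
  have sq: "smooth_on S ?q"
    by (intro smooth_on_intros smooth_grad_prod open_S u)
  have e: "smooth_on S (pull e)"
    by (rule smooth_on_cong[OF open_S _ sq]) (simp add: E del: o_apply)
  have pe: "partial k (pull e) y = (\<Sum>l\<in>UNIV. hess u k l y * X u l y)" if "y \<in> S" for k y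
  proof -
    have "partial k (pull e) y = partial k ?q y"
      by (rule partial_cong[OF open_S that e]) (simp add: E del: o_apply)
    also have "\<dots> = partial k (grad_prod_coeff M c u u) y / 2"
      by (subst partial_mult[OF smooth_grad_prod[OF u u] smooth_on_const that]) (simp add: partial_const)
    finally show ?thesis by (simp add: partial_grad_prod[OF that u u])
  qed
  have Xe: "X e i y = (\<Sum>k\<in>UNIV. A u i k y * X u k y)" if y: "y \<in> S" for i y
    unfolding grad_coeff_def[of M c e] pe[OF y] hess_endo_def sum_distrib_left sum_distrib_right
    by (subst sum.swap, intro sum.cong refl) (simp add: hess_sym[OF y u] mult_ac)
  have pXe: "partial i (X e i) x = (\<Sum>k\<in>UNIV. A u i k x * partial i (X u k) x + partial i (A u i k) x * X u k x)" for i
  proof -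
    have "partial i (X e i) x = partial i (\<lambda>y. \<Sum>k\<in>UNIV. A u i k y * X u k y) x"
      by (rule partial_cong[OF open_S x smooth_grad[OF e] Xe])
    also have "\<dots> = (\<Sum>k\<in>UNIV. partial i (\<lambda>y. A u i k y * X u k y) x)"
      by (rule partial_sum[OF _ x]) (intro smooth_on_intros smooth_hess_endo smooth_grad open_S u)
    finally show ?thesis
      by (simp add: partial_mult[OF smooth_hess_endo[OF u] smooth_grad[OF u] x])
  qed
  have pL: "partial k (laplace_coeff M c u) x = (\<Sum>i\<in>UNIV. partial k (A u i i) x)" for k
    unfolding laplace_eq_trace[abs_def] by (rule partial_sum[OF smooth_hess_endo[OF u] x])
  \<comment> \<open>The divergence of \<open>A X\<close>, with the derivative on \<open>X\<close>, on \<open>A\<close>, and the Christoffel term.\<close>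
  have 1: "laplace_coeff M c e x =
     (\<Sum>i\<in>UNIV. \<Sum>k\<in>UNIV. A u i k x * partial i (X u k) x)
   + (\<Sum>i\<in>UNIV. \<Sum>k\<in>UNIV. partial i (A u i k) x * X u k x)
   + (\<Sum>i\<in>UNIV. \<Sum>l\<in>UNIV. \<Gamma> i i l x * (\<Sum>k\<in>UNIV. A u l k x * X u k x))"
    by (simp add: laplace_eq_div[OF x e] pXe Xe[OF x] sum.distrib)
  have 2: "(\<Sum>i\<in>UNIV. \<Sum>k\<in>UNIV. A u i k x * partial i (X u k) x) =
     (\<Sum>i\<in>UNIV. \<Sum>k\<in>UNIV. A u i k x * A u k i x)
     - (\<Sum>i\<in>UNIV. \<Sum>k\<in>UNIV. \<Sum>l\<in>UNIV. A u i k x * \<Gamma> k i l x * X u l x)"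
    by (simp add: partial_grad[OF x u] right_diff_distrib sum_subtractf sum_distrib_left mult_ac)
  have 3: "(\<Sum>i\<in>UNIV. \<Sum>k\<in>UNIV. partial i (A u i k) x * X u k x)
     = (\<Sum>k\<in>UNIV. X u k x * partial k (laplace_coeff M c u) x)
     + (\<Sum>k\<in>UNIV. X u k x * (\<Sum>i\<in>UNIV. partial i (A u i k) x - partial k (A u i i) x))"
    by (subst sum.swap)
       (simp add: pL sum.distrib[symmetric] sum_subtractf right_diff_distrib sum_distrib_left mult_ac)
  have 4: "(\<Sum>k\<in>UNIV. X u k x * (\<Sum>i\<in>UNIV. partial i (A u i k) x - partial k (A u i i) x)) =
      (\<Sum>k\<in>UNIV. \<Sum>l\<in>UNIV. ricci_coeff M c k l x * X u k x * X u l x)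
    + (\<Sum>k\<in>UNIV. \<Sum>i\<in>UNIV. \<Sum>l\<in>UNIV. X u k x * \<Gamma> i k l x * A u l i x)
    - (\<Sum>k\<in>UNIV. \<Sum>i\<in>UNIV. \<Sum>l\<in>UNIV. X u k x * \<Gamma> i i l x * A u l k x)"
    unfolding contracted_ricci_identity[OF x u]
    by (simp add: distrib_left right_diff_distrib sum.distrib sum_subtractf sum_distrib_left mult_ac)
  \<comment> \<open>The next two facts match the leftover terms in \<open>\<Gamma> A X\<close> with those that they cancel.\<close>
  have 5: "(\<Sum>k\<in>UNIV. \<Sum>i\<in>UNIV. \<Sum>l\<in>UNIV. X u k x * \<Gamma> i k l x * A u l i x)
     = (\<Sum>i\<in>UNIV. \<Sum>k\<in>UNIV. \<Sum>l\<in>UNIV. A u i k x * \<Gamma> k i l x * X u l x)"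
  proof -
    have "(\<Sum>k\<in>UNIV. \<Sum>i\<in>UNIV. \<Sum>l\<in>UNIV. X u k x * \<Gamma> i k l x * A u l i x)
      = (\<Sum>k\<in>UNIV. \<Sum>l\<in>UNIV. \<Sum>i\<in>UNIV. X u k x * \<Gamma> i k l x * A u l i x)"
      by (intro sum.cong refl sum.swap)
    also have "\<dots> = (\<Sum>l\<in>UNIV. \<Sum>k\<in>UNIV. \<Sum>i\<in>UNIV. X u k x * \<Gamma> i k l x * A u l i x)"
      by (rule sum.swap)
    also have "\<dots> = (\<Sum>l\<in>UNIV. \<Sum>i\<in>UNIV. \<Sum>k\<in>UNIV. X u k x * \<Gamma> i k l x * A u l i x)"
      by (intro sum.cong refl sum.swap)
    finally show ?thesis by (simp add: \<Gamma>_sym[OF x] mult_ac)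
  qed
  have 6: "(\<Sum>i\<in>UNIV. \<Sum>l\<in>UNIV. \<Gamma> i i l x * (\<Sum>k\<in>UNIV. A u l k x * X u k x))
      = (\<Sum>k\<in>UNIV. \<Sum>i\<in>UNIV. \<Sum>l\<in>UNIV. X u k x * \<Gamma> i i l x * A u l k x)"
  proof -
    have "(\<Sum>k\<in>UNIV. \<Sum>i\<in>UNIV. \<Sum>l\<in>UNIV. X u k x * \<Gamma> i i l x * A u l k x)
       = (\<Sum>i\<in>UNIV. \<Sum>k\<in>UNIV. \<Sum>l\<in>UNIV. X u k x * \<Gamma> i i l x * A u l k x)"
      by (rule sum.swap)
    also have "\<dots> = (\<Sum>i\<in>UNIV. \<Sum>l\<in>UNIV. \<Sum>k\<in>UNIV. X u k x * \<Gamma> i i l x * A u l k x)"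
      by (intro sum.cong refl sum.swap)
    finally show ?thesis by (simp add: sum_distrib_left mult_ac)
  qed
  show ?thesis unfolding 1 2 3 4 5 6 by simp
qed

text \<open>The sum on the left is \<open>|Hess u|\<^sup>2\<close>. The traceless part \<open>s = Hess u - (\<Delta>u / n) g\<close> of the Hessian satisfies
\<open>0 \<le> tr (H s H s) = tr (A\<^sup>2) - (tr A)\<^sup>2 / n\<close>. Nonnegativity holds because \<open>H\<close> and \<open>s H s\<close> are
positive semidefinite.\<close>

lemma hess_norm_ge:
  assumes x: "x \<in> S" and u: "smooth_on S (pull u)"
  shows "(\<Sum>i\<in>UNIV. \<Sum>k\<in>UNIV. A u i k x * A u k i x) \<ge> (laplace_coeff M c u x)\<^sup>2 / CARD('n)"
proof -
  let ?t = "laplace_coeff M c u x"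
  define \<tau> where "\<tau> = ?t / CARD('n)"
  define s where "s i j = hess u i j x - \<tau> * G i j x" for i j
  define B where "B i k = (\<Sum>a\<in>UNIV. H i a x * s k a)" for i k
  have s_sym: "s i j = s j i" for i j
    by (simp add: s_def hess_sym[OF x u, of i j] G_sym[OF x, of i j])
  have B: "B i k = A u i k x - \<tau> * (if i = k then 1 else 0)" for i k
    using HG[OF x, of i k]
    by (simp add: B_def s_def hess_endo_def right_diff_distrib sum_subtractf sum_distrib_left
        G_sym[OF x, of k] mult_ac flip: sum_distrib_left)
  have nonneg: "(\<Sum>i\<in>UNIV. \<Sum>a\<in>UNIV. H i a x * (\<Sum>k\<in>UNIV. \<Sum>b\<in>UNIV. s i b * s a k * H k b x)) \<ge> 0"
  proof (rule trace_prod_nonneg)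
    fix z :: "'n \<Rightarrow> real"
    define w where "w b = (\<Sum>i\<in>UNIV. z i * s i b)" for b
    have ww: "w k * w b * h = (\<Sum>i\<in>UNIV. \<Sum>a\<in>UNIV. z i * z a * (s i b * s a k * h))" for k b h
    proof -
      have "w k * w b * h = (\<Sum>i\<in>UNIV. \<Sum>a\<in>UNIV. (z i * s i b) * (z a * s a k)) * h"
        unfolding w_def sum_product[symmetric] by simp
      also have "\<dots> = (\<Sum>i\<in>UNIV. \<Sum>a\<in>UNIV. z i * z a * (s i b * s a k * h))"
        unfolding sum_distrib_right by (intro sum.cong refl) (simp add: mult_ac)
      finally show ?thesis .
    qed
    have "0 \<le> (\<Sum>k\<in>UNIV. \<Sum>b\<in>UNIV. w k * w b * H k b x)"
      using H_pos[OF x, of w] by (cases "w = (\<lambda>i. 0)") auto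
    also have "\<dots> = (\<Sum>k\<in>UNIV. \<Sum>b\<in>UNIV. \<Sum>i\<in>UNIV. \<Sum>a\<in>UNIV. z i * z a * (s i b * s a k * H k b x))"
      by (intro sum.cong refl ww)
    also have "\<dots> = (\<Sum>i\<in>UNIV. \<Sum>a\<in>UNIV. \<Sum>k\<in>UNIV. \<Sum>b\<in>UNIV. z i * z a * (s i b * s a k * H k b x))"
      by (rule sum_swap_pairs)
    finally show "0 \<le> (\<Sum>i\<in>UNIV. \<Sum>a\<in>UNIV. z i * z a * (\<Sum>k\<in>UNIV. \<Sum>b\<in>UNIV. s i b * s a k * H k b x))"
      by (simp add: sum_distrib_left)
  next
    fix a :: "'n \<Rightarrow> real" assume "\<exists>i\<in>UNIV. a i \<noteq> 0"
    then show "(\<Sum>i\<in>UNIV. \<Sum>j\<in>UNIV. a i * a j * H i j x) > 0" by (intro H_pos[OF x]) auto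
  qed (auto intro: H_sym[OF x])
  have "(\<Sum>i\<in>UNIV. \<Sum>k\<in>UNIV. B i k * B k i)
     = (\<Sum>i\<in>UNIV. \<Sum>k\<in>UNIV. \<Sum>a\<in>UNIV. \<Sum>b\<in>UNIV. H i a x * (s i b * s a k * H k b x))"
    unfolding B_def sum_product by (intro sum.cong refl) (simp add: s_sym mult_ac)
  also have "\<dots> = (\<Sum>i\<in>UNIV. \<Sum>a\<in>UNIV. H i a x * (\<Sum>k\<in>UNIV. \<Sum>b\<in>UNIV. s i b * s a k * H k b x))"
    unfolding sum_distrib_left by (intro sum.cong refl sum.swap)
  finally have "0 \<le> (\<Sum>i\<in>UNIV. \<Sum>k\<in>UNIV. B i k * B k i)" using nonneg by simp
  also have "\<dots> = (\<Sum>i\<in>UNIV. \<Sum>k\<in>UNIV. A u i k x * A u k i x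
      - (if k = i then 2 * \<tau> * A u i i x - \<tau> * \<tau> else 0))"
    unfolding B by (intro sum.cong refl) (auto simp: algebra_simps)
  also have "\<dots> = (\<Sum>i\<in>UNIV. \<Sum>k\<in>UNIV. A u i k x * A u k i x) - 2 * \<tau> * ?t + \<tau> * \<tau> * CARD('n)"
    by (simp add: sum_subtractf laplace_eq_trace sum_distrib_left)
  also have "\<dots> = (\<Sum>i\<in>UNIV. \<Sum>k\<in>UNIV. A u i k x * A u k i x) - ?t\<^sup>2 / CARD('n)"
    by (simp add: \<tau>_def field_simps power2_eq_square)
  finally show ?thesis by simp
qed

end

section \<open>From coordinates to the manifold\<close>

text \<open>Smoothness on an open set; it serves coordinate functions, which are smooth on the domain of their chart.\<close>

definition smooth_in :: "('a, 'n::finite) riem_manifold \<Rightarrow> 'a set \<Rightarrow> ('a \<Rightarrow> real) \<Rightarrow> bool" where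
  "smooth_in M W f \<longleftrightarrow> (\<forall>c\<in>atlas M. smooth_on (snd c ` (fst c \<inter> W)) (f \<circ> chart_inv c))"

lemma smooth_in_subset: "smooth_in M W f \<Longrightarrow> V \<subseteq> W \<Longrightarrow> smooth_in M V f"
  unfolding smooth_in_def by (blast intro: smooth_on_subset)

lemma smooth_fun_imp_smooth_in: "smooth_fun M f \<Longrightarrow> smooth_in M W f"
  unfolding smooth_fun_def smooth_in_def by (blast intro: smooth_on_subset)

lemma smooth_nearI: "openin (mtop M) W \<Longrightarrow> smooth_in M W f \<Longrightarrow> p \<in> W \<Longrightarrow> smooth_near M p f"
  unfolding smooth_near_def smooth_in_def by blast

lemma smooth_nearE:
  assumes "smooth_near M p f"
  obtains W where "openin (mtop M) W" "p \<in> W" "smooth_in M W f"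
  using assms unfolding smooth_near_def smooth_in_def by blast

abbreviation (input) coord :: "('a, 'n::finite) chart \<Rightarrow> 'n \<Rightarrow> 'a \<Rightarrow> real" where
  "coord c i \<equiv> \<lambda>q. snd c q $ i"

abbreviation (input) grad_prod :: "('a, 'n::finite) riem_manifold \<Rightarrow> ('a \<Rightarrow> real) \<Rightarrow> ('a \<Rightarrow> real) \<Rightarrow> 'a \<Rightarrow> real" where
  "grad_prod M f h \<equiv> \<lambda>q. gmetric M q (gradient M f q) (gradient M h q)"

locale riemannian =
  fixes M :: "('a, 'n::finite) riem_manifold"
  assumes riemannian: "riemannian_manifold M"
begin

lemma is_chart: "c \<in> atlas M \<Longrightarrow> is_chart (mtop M) c"
  using riemannian unfolding riemannian_manifold_def smooth_atlas_def by blast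

lemma open_chart: "c \<in> atlas M \<Longrightarrow> openin (mtop M) (fst c)"
  using is_chart unfolding is_chart_def by blast

lemma ex_chart: "p \<in> topspace (mtop M) \<Longrightarrow> \<exists>c\<in>atlas M. p \<in> fst c"
  using riemannian unfolding riemannian_manifold_def smooth_atlas_def by blast

lemma chart_at: "p \<in> topspace (mtop M) \<Longrightarrow> chart_at M p \<in> atlas M \<and> p \<in> fst (chart_at M p)"
  unfolding chart_at_def by (rule someI_ex) (use ex_chart in blast)

lemma chart_topspace: "c \<in> atlas M \<Longrightarrow> q \<in> fst c \<Longrightarrow> q \<in> topspace (mtop M)"
  using openin_subset[OF open_chart] by blast

lemma inj_chart:
  assumes "c \<in> atlas M" shows "inj_on (snd c) (fst c)"
proof -
  have "topspace (subtopology (mtop M) (fst c)) = fst c"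
    using openin_subset[OF open_chart[OF assms]] by auto
  then show ?thesis
    using homeomorphic_imp_injective_map is_chart[OF assms] unfolding is_chart_def by metis
qed

lemma chart_inv_chart [simp]: "c \<in> atlas M \<Longrightarrow> q \<in> fst c \<Longrightarrow> chart_inv c (snd c q) = q"
  unfolding chart_inv_def using inj_chart by (simp add: inv_into_f_f)

lemma open_chart_image:
  assumes c: "c \<in> atlas M" and W: "openin (mtop M) W"
  shows "open (snd c ` (fst c \<inter> W))"
proof -
  have hom: "homeomorphic_map (subtopology (mtop M) (fst c)) (top_of_set (snd c ` fst c)) (snd c)"
    and op: "open (snd c ` fst c)"
    using is_chart[OF c] unfolding is_chart_def by auto
  have "openin (subtopology (mtop M) (fst c)) (fst c \<inter> W)"
    by (rule openin_subtopology_Int2[OF W])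
  then have "openin (top_of_set (snd c ` fst c)) (snd c ` (fst c \<inter> W))"
    using hom homeomorphic_map_openness_eq by blast
  then show ?thesis using op openin_open_eq by blast
qed

lemma smooth_transition:
  "c \<in> atlas M \<Longrightarrow> d \<in> atlas M \<Longrightarrow> smooth_on (snd d ` (fst d \<inter> fst c)) (snd c \<circ> chart_inv d)"
  using riemannian unfolding riemannian_manifold_def smooth_atlas_def by blast

lemma smooth_in_coord:
  assumes c: "c \<in> atlas M" shows "smooth_in M (fst c) (coord c i)"
  unfolding smooth_in_def
proof
  fix d assume d: "d \<in> atlas M"
  have "smooth_on (snd d ` (fst d \<inter> fst c)) (\<lambda>x. (snd c \<circ> chart_inv d) x $ i)"
    by (rule smooth_on_nth[OF open_chart_image[OF d open_chart[OF c]] smooth_transition[OF c d]])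
  then show "smooth_on (snd d ` (fst d \<inter> fst c)) (coord c i \<circ> chart_inv d)"
    by (simp add: comp_def)
qed

lemma pull_differentiable:
  assumes "c \<in> atlas M" "q \<in> fst c" "smooth_near M q f"
  shows "(f \<circ> chart_inv c) differentiable (at (snd c q))"
  using assms(3)
proof (rule smooth_nearE)
  fix W assume "q \<in> W" "smooth_in M W f"
  then show ?thesis using assms unfolding smooth_in_def by (blast intro: smooth_on_differentiable)
qed

lemma chart_vec_apply:
  assumes "c \<in> atlas M" "q \<in> fst c" "smooth_near M q f"
  shows "chart_vec M c q a f = (\<Sum>i\<in>UNIV. a $ i * partial i (f \<circ> chart_inv c) (snd c q))"
  unfolding chart_vec_def using frechet_derivative_partials[OF pull_differentiable[OF assms]] assms(3)
  by simp

lemma chart_vec_linear: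
  assumes "c \<in> atlas M" "q \<in> fst c"
  shows "chart_vec M c q (r *\<^sub>R a + s *\<^sub>R b) = (\<lambda>f. r * chart_vec M c q a f + s * chart_vec M c q b f)"
proof
  fix f
  show "chart_vec M c q (r *\<^sub>R a + s *\<^sub>R b) f = r * chart_vec M c q a f + s * chart_vec M c q b f"
  proof (cases "smooth_near M q f")
    case True
    show ?thesis
      unfolding chart_vec_apply[OF assms True]
      by (simp add: sum_distrib_left sum.distrib algebra_simps)
  qed (simp add: chart_vec_def)
qed

text \<open>The chain rule for the transition map. It shows that each chart at \<open>q\<close> yields all tangent vectors at \<open>q\<close>.\<close>

lemma chart_vec_change:
  assumes c: "c \<in> atlas M" "q \<in> fst c" and d: "d \<in> atlas M" "q \<in> fst d"
  shows "chart_vec M d q a = chart_vec M c q (frechet_derivative (snd c \<circ> chart_inv d) (at (snd d q)) a)"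
proof
  fix f
  show "chart_vec M d q a f = chart_vec M c q (frechet_derivative (snd c \<circ> chart_inv d) (at (snd d q)) a) f"
  proof (cases "smooth_near M q f")
    case True
    have t: "(snd c \<circ> chart_inv d) differentiable (at (snd d q))"
      by (rule smooth_on_differentiable[OF smooth_transition[OF c(1) d(1)]]) (use c d in blast)
    have "(snd c \<circ> chart_inv d) (snd d q) = snd c q" using d by simp
    then have "frechet_derivative ((f \<circ> chart_inv c) \<circ> (snd c \<circ> chart_inv d)) (at (snd d q))
      = frechet_derivative (f \<circ> chart_inv c) (at (snd c q)) \<circ>
        frechet_derivative (snd c \<circ> chart_inv d) (at (snd d q))"
      using frechet_derivative_compose[OF t] pull_differentiable[OF c True] by simp
    moreover have "frechet_derivative (f \<circ> chart_inv d) (at (snd d q))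
        = frechet_derivative ((f \<circ> chart_inv c) \<circ> (snd c \<circ> chart_inv d)) (at (snd d q))"
    proof (rule frechet_derivative_transform_within_open[OF pull_differentiable[OF d True]
             open_chart_image[OF d(1) open_chart[OF c(1)]]])
      show "snd d q \<in> snd d ` (fst d \<inter> fst c)" using c d by blast
    qed (use c d in auto)
    ultimately show ?thesis using True by (simp add: chart_vec_def)
  qed (simp add: chart_vec_def)
qed

lemma tangent_space_eq:
  assumes "c \<in> atlas M" "q \<in> fst c"
  shows "tangent_space M q = range (chart_vec M c q)"
  unfolding tangent_space_def using assms chart_vec_change[OF assms] by blast

lemma partial_coord:
  assumes "c \<in> atlas M" "q \<in> fst c"
  shows "partial j (coord c i \<circ> chart_inv c) (snd c q) = (if i = j then 1 else 0)"
proof -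
  have "partial j (coord c i \<circ> chart_inv c) (snd c q) = partial j (\<lambda>x. x $ i) (snd c q)"
  proof (rule partial_cong)
    show "open (snd c ` fst c)" using open_chart_image[OF assms(1) open_chart[OF assms(1)]] by simp
    show "smooth_on (snd c ` fst c) (coord c i \<circ> chart_inv c)"
      using smooth_in_coord[OF assms(1)] assms(1) unfolding smooth_in_def by fastforce
  qed (use assms in auto)
  then show ?thesis by (simp add: partial_nth)
qed

lemma smooth_near_coord: "c \<in> atlas M \<Longrightarrow> q \<in> fst c \<Longrightarrow> smooth_near M q (coord c i)"
  by (rule smooth_nearI[OF open_chart smooth_in_coord])

lemma vcomp_chart_vec [simp]:
  assumes "c \<in> atlas M" "q \<in> fst c"
  shows "vcomp c (chart_vec M c q a) i = a $ i"
  unfolding vcomp_def chart_vec_apply[OF assms smooth_near_coord[OF assms]] partial_coord[OF assms]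
  by (simp add: if_distrib[of "\<lambda>t. _ * t"] cong: if_cong)

lemma metric_facts:
  assumes "q \<in> topspace (mtop M)"
  shows "v \<in> tangent_space M q \<Longrightarrow> w \<in> tangent_space M q \<Longrightarrow> gmetric M q v w = gmetric M q w v"
    and "v \<in> tangent_space M q \<Longrightarrow> v' \<in> tangent_space M q \<Longrightarrow> w \<in> tangent_space M q \<Longrightarrow>
      gmetric M q (\<lambda>f. a * v f + b * v' f) w = a * gmetric M q v w + b * gmetric M q v' w"
    and "v \<in> tangent_space M q \<Longrightarrow> v \<noteq> (\<lambda>f. 0) \<Longrightarrow> gmetric M q v v > 0"
  using riemannian assms unfolding riemannian_manifold_def riemannian_metric_def by blast+

lemma chart_vec_in: "c \<in> atlas M \<Longrightarrow> q \<in> fst c \<Longrightarrow> chart_vec M c q a \<in> tangent_space M q"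
  unfolding tangent_space_def by blast

lemma gmetric_chart_vec:
  assumes c: "c \<in> atlas M" "q \<in> fst c"
  shows "gmetric M q (chart_vec M c q a) (chart_vec M c q b)
    = (\<Sum>i\<in>UNIV. \<Sum>j\<in>UNIV. a $ i * b $ j * metric_coeff M c (snd c q) $ i $ j)"
proof -
  note q = chart_topspace[OF c] and t = chart_vec_in[OF c]
  let ?g = "\<lambda>a b. gmetric M q (chart_vec M c q a) (chart_vec M c q b)"
  have lin: "linear (\<lambda>a. ?g a b)" for b
  proof (rule linearI)
    show "?g (x + y) b = ?g x b + ?g y b" for x y
      using metric_facts(2)[OF q t t t, of 1 x 1 y b] chart_vec_linear[OF c, of 1 x 1 y] by simp
    show "?g (r *\<^sub>R x) b = r *\<^sub>R ?g x b" for r x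
      using metric_facts(2)[OF q t t t, of r x 0 0 b] chart_vec_linear[OF c, of r x 0 0] by simp
  qed
  have sym: "?g a b = ?g b a" for a b by (rule metric_facts(1)[OF q t t])
  have ex: "?g a b = (\<Sum>i\<in>UNIV. a $ i * ?g (axis i 1) b)" for a b
  proof -
    have "?g a b = ?g (\<Sum>i\<in>UNIV. a $ i *\<^sub>R axis i 1) b"
      using basis_expansion[of a] by (simp add: scalar_mult_eq_scaleR)
    also have "\<dots> = (\<Sum>i\<in>UNIV. a $ i * ?g (axis i 1) b)"
      using linear_sum[OF lin[of b], of "\<lambda>i. a $ i *\<^sub>R axis i 1" UNIV] linear_scale[OF lin[of b]] by simp
    finally show ?thesis .
  qed
  have "?g a b = (\<Sum>i\<in>UNIV. a $ i * (\<Sum>j\<in>UNIV. b $ j * ?g (axis i 1) (axis j 1)))"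
    by (subst ex, intro sum.cong refl arg_cong2[where f="(*)"], subst sym, subst ex) (simp add: sym)
  then show ?thesis
    using c by (simp add: metric_coeff_def Let_def sum_distrib_left mult_ac)
qed

text \<open>The coordinate expression of the metric, for vectors that need not be given in the chart \<open>c\<close>. Used in two
charts at once, it replaces the transformation law of the metric coefficients.\<close>

lemma gmetric_vcomp:
  assumes c: "c \<in> atlas M" "q \<in> fst c" and v: "v \<in> tangent_space M q" "w \<in> tangent_space M q"
  shows "gmetric M q v w = (\<Sum>i\<in>UNIV. \<Sum>j\<in>UNIV. vcomp c v i * vcomp c w j * metric_coeff M c (snd c q) $ i $ j)"
proof -
  obtain a b where "v = chart_vec M c q a" "w = chart_vec M c q b"
    using v unfolding tangent_space_eq[OF c] by blast
  then show ?thesis using c by (simp add: gmetric_chart_vec)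
qed

lemma metric_patch:
  assumes c: "c \<in> atlas M" and W: "openin (mtop M) W"
  shows "metric_patch M c (snd c ` (fst c \<inter> W))"
proof
  show "open (snd c ` (fst c \<inter> W))" by (rule open_chart_image[OF assms])
  show "smooth_on (snd c ` (fst c \<inter> W)) (\<lambda>x. metric_coeff M c x $ i $ j)" for i j
    using riemannian c unfolding riemannian_manifold_def riemannian_metric_def
    by (blast intro: smooth_on_subset)
  fix x assume "x \<in> snd c ` (fst c \<inter> W)"
  then obtain q where q: "q \<in> fst c" "x = snd c q" by blast
  note t = chart_vec_in[OF c q(1)] and p = chart_topspace[OF c q(1)]
  show "metric_coeff M c x $ i $ j = metric_coeff M c x $ j $ i" for i j
    using metric_facts(1)[OF p t t] c q by (simp add: metric_coeff_def Let_def)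
  fix a :: "real^'n" assume "a \<noteq> 0"
  then obtain i where "a $ i \<noteq> 0" by (auto simp: vec_eq_iff)
  then have "vcomp c (chart_vec M c q a) i \<noteq> 0" using c q by simp
  then have "chart_vec M c q a \<noteq> (\<lambda>f. 0)" by (auto simp: vcomp_def)
  from metric_facts(3)[OF p t this]
  show "(\<Sum>i\<in>UNIV. \<Sum>j\<in>UNIV. a $ i * a $ j * metric_coeff M c x $ i $ j) > 0"
    using gmetric_chart_vec[OF c q(1)] q by simp
qed

lemma metric_patch_full:
  assumes c: "c \<in> atlas M" shows "metric_patch M c (snd c ` fst c)"
  using metric_patch[OF c open_chart[OF c]] by simp

text \<open>The definite description in the definition of the gradient denotes: testing a vector against the coordinate
vectors determines its components, because the matrix of the metric is invertible.\<close>

lemma gradient_eq: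
  assumes c: "c \<in> atlas M" "q \<in> fst c" and f: "smooth_near M q f"
  shows "gradient M f q = chart_vec M c q (\<chi> i. grad_coeff M c f i (snd c q))"
proof -
  interpret P: metric_patch M c "snd c ` fst c" by (rule metric_patch_full[OF c(1)])
  let ?x = "snd c q" and ?X = "\<chi> i. grad_coeff M c f i (snd c q)"
  have x: "?x \<in> snd c ` fst c" using c by blast
  have X: "(\<Sum>i\<in>UNIV. ?X $ i * metric_coeff M c ?x $ i $ j) = partial j (f \<circ> chart_inv c) ?x" for j
  proof -
    have "(\<Sum>i\<in>UNIV. ?X $ i * metric_coeff M c ?x $ i $ j)
        = (\<Sum>i\<in>UNIV. metric_coeff M c ?x $ j $ i * grad_coeff M c f i ?x)"
      by (intro sum.cong refl) (simp add: P.G_sym[OF x, of _ j])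
    also have "\<dots> = partial j (f \<circ> chart_inv c) ?x"
      unfolding grad_coeff_def by (rule P.GH_apply[OF x])
    finally show ?thesis .
  qed
  have g: "gmetric M q (chart_vec M c q a) (chart_vec M c q b)
      = (\<Sum>j\<in>UNIV. b $ j * (\<Sum>i\<in>UNIV. a $ i * metric_coeff M c ?x $ i $ j))" for a b
    unfolding gmetric_chart_vec[OF c] by (subst sum.swap) (simp add: sum_distrib_left mult_ac)
  show ?thesis
    unfolding gradient_def
  proof (rule the_equality, intro conjI ballI)
    show "chart_vec M c q ?X \<in> tangent_space M q" by (rule chart_vec_in[OF c])
  next
    fix w assume "w \<in> tangent_space M q"
    then obtain b where b: "w = chart_vec M c q b" unfolding tangent_space_eq[OF c] by blast
    show "gmetric M q (chart_vec M c q ?X) w = w f"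
      unfolding b g X chart_vec_apply[OF c f] ..
  next
    fix v assume "v \<in> tangent_space M q \<and> (\<forall>w\<in>tangent_space M q. gmetric M q v w = w f)"
    then have v: "v \<in> tangent_space M q" and vw: "\<forall>w\<in>tangent_space M q. gmetric M q v w = w f"
      by auto
    obtain a where a: "v = chart_vec M c q a" using v unfolding tangent_space_eq[OF c] by blast
    have ax: "(\<Sum>k\<in>UNIV. axis j 1 $ k * h k) = h j" for j and h :: "'n \<Rightarrow> real"
      by (simp add: axis_def if_distrib[of "\<lambda>t. t * _"] cong: if_cong)
    have Ga: "(\<Sum>i\<in>UNIV. metric_coeff M c ?x $ j $ i * a $ i) = partial j (f \<circ> chart_inv c) ?x" for j
    proof -
      have "(\<Sum>i\<in>UNIV. a $ i * metric_coeff M c ?x $ i $ j) = partial j (f \<circ> chart_inv c) ?x"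
        using vw[rule_format, OF chart_vec_in[OF c, of "axis j 1"]]
        unfolding a g chart_vec_apply[OF c f] ax .
      moreover have "(\<Sum>i\<in>UNIV. metric_coeff M c ?x $ j $ i * a $ i)
          = (\<Sum>i\<in>UNIV. a $ i * metric_coeff M c ?x $ i $ j)"
        by (intro sum.cong refl) (simp add: P.G_sym[OF x, of _ j])
      ultimately show ?thesis by simp
    qed
    have "a = ?X"
    proof (rule vec_eq_iff[THEN iffD2], rule allI)
      fix i
      have "a $ i = (\<Sum>k\<in>UNIV. inv_metric_coeff M c ?x $ i $ k *
          (\<Sum>l\<in>UNIV. metric_coeff M c ?x $ k $ l * a $ l))"
        by (rule P.HG_apply[OF x, symmetric])
      also have "\<dots> = grad_coeff M c f i ?x"
        unfolding Ga grad_coeff_def ..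
      finally show "a $ i = ?X $ i" by simp
    qed
    then show "v = chart_vec M c q ?X" unfolding a by simp
  qed
qed

lemma gradient_in:
  assumes "q \<in> topspace (mtop M)" "smooth_near M q f"
  shows "gradient M f q \<in> tangent_space M q"
proof -
  obtain c where c: "c \<in> atlas M" "q \<in> fst c" using ex_chart[OF assms(1)] by blast
  show ?thesis unfolding gradient_eq[OF c assms(2)] by (rule chart_vec_in[OF c])
qed

lemma grad_prod_commute:
  assumes "q \<in> topspace (mtop M)" "smooth_near M q f" "smooth_near M q h"
  shows "grad_prod M f h q = grad_prod M h f q"
  using metric_facts(1)[OF assms(1)] gradient_in assms by blast

lemma grad_prod_eq:
  assumes c: "c \<in> atlas M" "q \<in> fst c" and f: "smooth_near M q f" "smooth_near M q h"
  shows "grad_prod M f h q = grad_prod_coeff M c f h (snd c q)"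
proof -
  interpret P: metric_patch M c "snd c ` fst c" by (rule metric_patch_full[OF c(1)])
  let ?x = "snd c q"
  have x: "?x \<in> snd c ` fst c" using c by blast
  have "grad_prod M f h q = (\<Sum>i\<in>UNIV. grad_coeff M c f i ?x *
      (\<Sum>j\<in>UNIV. metric_coeff M c ?x $ i $ j * grad_coeff M c h j ?x))"
    unfolding gradient_eq[OF c f(1)] gradient_eq[OF c f(2)] gmetric_chart_vec[OF c]
    by (simp add: sum_distrib_left mult_ac)
  also have "\<dots> = (\<Sum>i\<in>UNIV. grad_coeff M c f i ?x * partial i (h \<circ> chart_inv c) ?x)"
    unfolding grad_coeff_def[of M c h] P.GH_apply[OF x] ..
  finally show ?thesis unfolding grad_prod_coeff_def .
qed

section \<open>Chart independence of the Hessian and the Laplacian\<close>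

lemma pull_grad_prod:
  assumes c: "c \<in> atlas M" and W: "openin (mtop M) W" and f: "smooth_in M W f" "smooth_in M W h"
    and x: "x \<in> snd c ` (fst c \<inter> W)"
  shows "(grad_prod M f h \<circ> chart_inv c) x = grad_prod_coeff M c f h x"
proof -
  obtain q where q: "q \<in> fst c" "q \<in> W" "x = snd c q" using x by blast
  show ?thesis
    using grad_prod_eq[OF c q(1) smooth_nearI[OF W f(1) q(2)] smooth_nearI[OF W f(2) q(2)]] c q
    by simp
qed

lemma smooth_in_pull: "smooth_in M W f \<Longrightarrow> c \<in> atlas M \<Longrightarrow> smooth_on (snd c ` (fst c \<inter> W)) (f \<circ> chart_inv c)"
  unfolding smooth_in_def by blast

lemma smooth_in_grad_prod:
  assumes W: "openin (mtop M) W" and f: "smooth_in M W f" "smooth_in M W h"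
  shows "smooth_in M W (grad_prod M f h)"
  unfolding smooth_in_def
proof
  fix c assume c: "c \<in> atlas M"
  interpret P: metric_patch M c "snd c ` (fst c \<inter> W)" by (rule metric_patch[OF c W])
  show "smooth_on (snd c ` (fst c \<inter> W)) (grad_prod M f h \<circ> chart_inv c)"
    by (rule smooth_on_cong[OF P.open_S _ P.smooth_grad_prod[OF f[THEN smooth_in_pull, OF c]]])
       (simp only: pull_grad_prod[OF c W f])
qed

lemma partial_pull_grad_prod:
  assumes c: "c \<in> atlas M" and W: "openin (mtop M) W" and f: "smooth_in M W f" "smooth_in M W h"
    and x: "x \<in> snd c ` (fst c \<inter> W)"
  shows "partial j (grad_prod M f h \<circ> chart_inv c) x
    = (\<Sum>a\<in>UNIV. hess_coeff M c f j a x * grad_coeff M c h a x)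
    + (\<Sum>a\<in>UNIV. hess_coeff M c h j a x * grad_coeff M c f a x)"
proof -
  interpret P: metric_patch M c "snd c ` (fst c \<inter> W)" by (rule metric_patch[OF c W])
  have "partial j (grad_prod M f h \<circ> chart_inv c) x = partial j (grad_prod_coeff M c f h) x"
    by (rule partial_cong[OF P.open_S x smooth_in_pull[OF smooth_in_grad_prod[OF W f] c]])
       (rule pull_grad_prod[OF c W f])
  then show ?thesis
    by (simp add: P.partial_grad_prod[OF x f[THEN smooth_in_pull, OF c]])
qed

lemma grad_prod_grad_prod:
  assumes c: "c \<in> atlas M" "q \<in> fst c" and W: "openin (mtop M) W" "q \<in> W"
    and f: "smooth_in M W f" "smooth_in M W h" "smooth_in M W k"
  shows "grad_prod M h (grad_prod M f k) q
    = (\<Sum>i\<in>UNIV. \<Sum>j\<in>UNIV. hess_coeff M c f i j (snd c q) * grad_coeff M c h i (snd c q) * grad_coeff M c k j (snd c q))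
    + (\<Sum>i\<in>UNIV. \<Sum>j\<in>UNIV. hess_coeff M c k i j (snd c q) * grad_coeff M c h i (snd c q) * grad_coeff M c f j (snd c q))"
proof -
  have x: "snd c q \<in> snd c ` (fst c \<inter> W)" using c W by blast
  show ?thesis
    unfolding grad_prod_eq[OF c smooth_nearI[OF W(1) f(2) W(2)]
        smooth_nearI[OF W(1) smooth_in_grad_prod[OF W(1) f(1,3)] W(2)]]
      grad_prod_coeff_def partial_pull_grad_prod[OF c(1) W(1) f(1,3) x]
    by (simp add: distrib_left sum.distrib sum_distrib_left mult_ac)
qed

text \<open>The right-hand side contains no coordinates: the Hessian on gradients is determined by the product
\<open>\<langle>\<nabla>f, \<nabla>h\<rangle>\<close> alone, and so are the Hessian and the Laplacian in every chart. The identity takes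
the place of the transformation law of the Christoffel symbols. The three terms on the right expand by the
Leibniz rule, and all but two copies of \<open>Hess f(\<nabla>h, \<nabla>k)\<close> cancel.\<close>

lemma hessian_by_grad_prod:
  assumes c: "c \<in> atlas M" "q \<in> fst c" and W: "openin (mtop M) W" "q \<in> W"
    and f: "smooth_in M W f" "smooth_in M W h" "smooth_in M W k"
  shows "(\<Sum>i\<in>UNIV. \<Sum>j\<in>UNIV. hess_coeff M c f i j (snd c q) * grad_coeff M c h i (snd c q) * grad_coeff M c k j (snd c q))
    = (grad_prod M h (grad_prod M f k) q + grad_prod M k (grad_prod M f h) q
       - grad_prod M f (grad_prod M h k) q) / 2"
proof -
  interpret P: metric_patch M c "snd c ` (fst c \<inter> W)" by (rule metric_patch[OF c(1) W(1)])
  have x: "snd c q \<in> snd c ` (fst c \<inter> W)" using c W by blast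
  define B where "B f h k = (\<Sum>i\<in>UNIV. \<Sum>j\<in>UNIV. hess_coeff M c f i j (snd c q) *
      grad_coeff M c h i (snd c q) * grad_coeff M c k j (snd c q))" for f h k
  have sym: "B f h k = B f k h" if "smooth_in M W f" for f h k
    unfolding B_def
    by (subst sum.swap, intro sum.cong refl) (simp add: P.hess_sym[OF x smooth_in_pull[OF that c(1)]] mult_ac)
  note g = grad_prod_grad_prod[OF c W, folded B_def]
  show ?thesis
    unfolding B_def[symmetric] g[OF f] g[OF f(1,3,2)] g[OF f(2,1,3)]
    using sym[OF f(1), of h k] sym[OF f(2), of f k] sym[OF f(3), of f h] by simp
qed

text \<open>The right-hand side does not mention \<open>d\<close>, so \<open>laplace_coeff M d f\<close> has the same value in every chart around
\<open>q\<close>. It is \<open>\<Sum>a b. g\<^sub>a\<^sub>b Hess f(\<nabla>x\<^sup>a, \<nabla>x\<^sup>b)\<close>, the metric trace of the Hessian computed on the gradients of the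
coordinate functions \<open>x\<^sup>a\<close> of \<open>c\<close>.\<close>

lemma laplace_coeff_by_coords:
  assumes c: "c \<in> atlas M" "q \<in> fst c" and d: "d \<in> atlas M" "q \<in> fst d"
    and W: "openin (mtop M) W" "q \<in> W" and f: "smooth_in M W f"
  shows "laplace_coeff M d f (snd d q) =
    (\<Sum>a\<in>UNIV. \<Sum>b\<in>UNIV. metric_coeff M c (snd c q) $ a $ b *
      ((grad_prod M (coord c a) (grad_prod M f (coord c b)) q + grad_prod M (coord c b) (grad_prod M f (coord c a)) q
       - grad_prod M f (grad_prod M (coord c a) (coord c b)) q) / 2))"
proof -
  interpret D: metric_patch M d "snd d ` fst d" by (rule metric_patch_full[OF d(1)])
  let ?x = "snd d q"
  have x: "?x \<in> snd d ` fst d" using d by blast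
  define H where "H i j = inv_metric_coeff M d ?x $ i $ j" for i j
  define Y where "Y a i = grad_coeff M d (coord c a) i ?x" for a i
  \<comment> \<open>The vector \<open>w i\<close> is the gradient of the \<open>i\<close>-th coordinate of \<open>d\<close>. Evaluating \<open>\<langle>w i, w j\<rangle>\<close> in both charts
      gives \<open>key\<close>.\<close>
  define w where "w i = chart_vec M d q (\<chi> k. H i k)" for i
  have wt: "w i \<in> tangent_space M q" for i unfolding w_def by (rule chart_vec_in[OF d])
  have wc: "vcomp c (w i) a = Y a i" for a i
    unfolding vcomp_def w_def chart_vec_apply[OF d smooth_near_coord[OF c]] Y_def grad_coeff_def H_def by simp
  have wd: "vcomp d (w i) k = H i k" for i k
    unfolding w_def using d by simp
  have key: "(\<Sum>a\<in>UNIV. \<Sum>b\<in>UNIV. Y a i * Y b j * metric_coeff M c (snd c q) $ a $ b) = H i j" for i j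
  proof -
    have "(\<Sum>a\<in>UNIV. \<Sum>b\<in>UNIV. Y a i * Y b j * metric_coeff M c (snd c q) $ a $ b) = gmetric M q (w i) (w j)"
      unfolding gmetric_vcomp[OF c wt wt] wc ..
    also have "\<dots> = (\<Sum>k\<in>UNIV. H i k * (\<Sum>l\<in>UNIV. metric_coeff M d ?x $ k $ l * H j l))"
      unfolding gmetric_vcomp[OF d wt wt] wd by (simp add: sum_distrib_left mult_ac)
    also have "\<dots> = H j i" unfolding H_def by (rule D.HG_apply[OF x])
    finally show ?thesis using D.H_sym[OF x] by (simp add: H_def)
  qed
  \<comment> \<open>The coordinate functions of \<open>c\<close> are smooth on its domain only.\<close>
  define V where "V = W \<inter> fst c"
  have V: "openin (mtop M) V" "q \<in> V"
    unfolding V_def using W c openin_Int[OF W(1) open_chart[OF c(1)]] by auto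
  have sm: "smooth_in M V f" "smooth_in M V (coord c a)" for a
    using smooth_in_subset f smooth_in_coord[OF c(1)] unfolding V_def by blast+
  have "(\<Sum>a\<in>UNIV. \<Sum>b\<in>UNIV. metric_coeff M c (snd c q) $ a $ b *
      ((grad_prod M (coord c a) (grad_prod M f (coord c b)) q + grad_prod M (coord c b) (grad_prod M f (coord c a)) q
       - grad_prod M f (grad_prod M (coord c a) (coord c b)) q) / 2))
    = (\<Sum>a\<in>UNIV. \<Sum>b\<in>UNIV. \<Sum>i\<in>UNIV. \<Sum>j\<in>UNIV.
        hess_coeff M d f i j ?x * (Y a i * Y b j * metric_coeff M c (snd c q) $ a $ b))"
    unfolding hessian_by_grad_prod[OF d V sm(1) sm(2) sm(2), symmetric] Y_def[symmetric]
    by (simp add: sum_distrib_left mult_ac)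
  also have "\<dots> = (\<Sum>i\<in>UNIV. \<Sum>j\<in>UNIV. \<Sum>a\<in>UNIV. \<Sum>b\<in>UNIV.
        hess_coeff M d f i j ?x * (Y a i * Y b j * metric_coeff M c (snd c q) $ a $ b))"
    by (rule sum_swap_pairs)
  also have "\<dots> = laplace_coeff M d f ?x"
    unfolding sum_distrib_left[symmetric] key by (simp add: laplace_coeff_def H_def mult.commute)
  finally show ?thesis by simp
qed

text \<open>By definition the Laplacian is computed at each point in a chart selected for that point. Since the value
does not depend on the chart, one chart serves a whole neighbourhood, and the Laplacian can be
differentiated.\<close>

lemma laplacian_eq:
  assumes c: "c \<in> atlas M" "q \<in> fst c" and f: "smooth_near M q f"
  shows "laplacian M f q = laplace_coeff M c f (snd c q)"
proof -
  obtain W where W: "openin (mtop M) W" "q \<in> W" "smooth_in M W f" using f by (rule smooth_nearE)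
  have d: "chart_at M q \<in> atlas M" "q \<in> fst (chart_at M q)" using chart_at chart_topspace[OF c] by auto
  have "laplacian M f q = laplace_coeff M (chart_at M q) f (snd (chart_at M q) q)"
    by (simp add: laplacian_def laplace_coeff_def Let_def)
  then show ?thesis
    using laplace_coeff_by_coords[OF c d W] laplace_coeff_by_coords[OF c c W] by simp
qed

lemma smooth_in_laplacian:
  assumes W: "openin (mtop M) W" and f: "smooth_in M W f"
  shows "smooth_in M W (laplacian M f)"
  unfolding smooth_in_def
proof
  fix c assume c: "c \<in> atlas M"
  interpret P: metric_patch M c "snd c ` (fst c \<inter> W)" by (rule metric_patch[OF c W])
  show "smooth_on (snd c ` (fst c \<inter> W)) (laplacian M f \<circ> chart_inv c)"
  proof (rule smooth_on_cong[OF P.open_S _ P.smooth_laplace[OF smooth_in_pull[OF f c]]])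
    fix x assume "x \<in> snd c ` (fst c \<inter> W)"
    then obtain q where q: "q \<in> fst c" "q \<in> W" "x = snd c q" by blast
    then show "laplace_coeff M c f x = (laplacian M f \<circ> chart_inv c) x"
      using laplacian_eq[OF c q(1) smooth_nearI[OF W f q(2)]] c by simp
  qed
qed

section \<open>The weighted Bochner inequality\<close>

text \<open>In the chart at \<open>p\<close> the left-hand side equals \<open>Ric(\<nabla>u, \<nabla>u) + Hess \<psi>(\<nabla>u, \<nabla>u) + |Hess u|\<^sup>2\<close>: the unweighted
part is Bochner's formula, and the terms with \<open>\<psi>\<close> are
\<open>\<langle>\<nabla>\<langle>\<nabla>u, \<nabla>\<psi>\<rangle>, \<nabla>u\<rangle> - \<langle>\<nabla>(|\<nabla>u|\<^sup>2 / 2), \<nabla>\<psi>\<rangle>\<close>, in which the two copies of \<open>Hess u(\<nabla>u, \<nabla>\<psi>)\<close> cancel. What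
remains to compare is \<open>|Hess u|\<^sup>2 \<ge> t\<^sup>2 / n\<close> with \<open>t = \<Delta>u\<close> and \<open>b = \<langle>\<nabla>u, \<nabla>\<psi>\<rangle>\<close>.\<close>

lemma weighted_bochner_ineq:
  assumes p: "p \<in> topspace (mtop M)" and \<psi>: "smooth_fun M \<psi>" and u: "smooth_fun M u" and N: "N < 0"
  shows "weighted_laplacian M \<psi> (\<lambda>q. grad_prod M u u q / 2) p
      - gmetric M p (gradient M (weighted_laplacian M \<psi> u) p) (gradient M u p)
    \<ge> weighted_Ric M \<psi> N p (gradient M u p) + (weighted_laplacian M \<psi> u p)\<^sup>2 / N"
proof -
  define c where "c = chart_at M p"
  have c: "c \<in> atlas M" "p \<in> fst c" using chart_at[OF p] unfolding c_def by auto
  define W where "W = topspace (mtop M)"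
  have W: "openin (mtop M) W" "p \<in> W" unfolding W_def using p by auto
  define S where "S = snd c ` (fst c \<inter> W)"
  define x where "x = snd c p"
  have x: "x \<in> S" unfolding S_def x_def using c W by blast
  interpret P: metric_patch M c S unfolding S_def by (rule metric_patch[OF c(1) W(1)])
  have su: "smooth_in M W u" and s\<psi>: "smooth_in M W \<psi>"
    using u \<psi> by (auto intro: smooth_fun_imp_smooth_in)
  have pu: "smooth_on S (u \<circ> chart_inv c)" and p\<psi>: "smooth_on S (\<psi> \<circ> chart_inv c)"
    unfolding S_def using su s\<psi> c by (auto intro: smooth_in_pull)
  note near = smooth_nearI[OF W(1) _ W(2)]
  let ?E = "\<lambda>q. grad_prod M u u q / 2" and ?L = "weighted_laplacian M \<psi> u"
  let ?X = "\<lambda>f i. grad_coeff M c f i x" and ?h = "\<lambda>f i j. hess_coeff M c f i j x"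
  have sE: "smooth_in M W ?E"
    unfolding smooth_in_def
  proof
    fix d assume d: "d \<in> atlas M"
    have "smooth_on (snd d ` (fst d \<inter> W)) (\<lambda>y. (grad_prod M u u \<circ> chart_inv d) y * (1/2))"
      by (intro smooth_on_mult smooth_on_const open_chart_image[OF d W(1)] smooth_in_pull[OF _ d]
          smooth_in_grad_prod[OF W(1) su su])
    then show "smooth_on (snd d ` (fst d \<inter> W)) (?E \<circ> chart_inv d)" by (simp add: comp_def)
  qed
  have sL: "smooth_in M W ?L"
    unfolding smooth_in_def
  proof
    fix d assume d: "d \<in> atlas M"
    have "smooth_on (snd d ` (fst d \<inter> W))
        (\<lambda>y. (laplacian M u \<circ> chart_inv d) y - (grad_prod M u \<psi> \<circ> chart_inv d) y)"
      by (intro smooth_on_diff open_chart_image[OF d W(1)] smooth_in_pull[OF _ d]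
          smooth_in_grad_prod[OF W(1) su s\<psi>] smooth_in_laplacian[OF W(1) su])
    then show "smooth_on (snd d ` (fst d \<inter> W)) (?L \<circ> chart_inv d)"
      by (simp add: comp_def weighted_laplacian_def)
  qed
  have E: "(?E \<circ> chart_inv c) y = grad_prod_coeff M c u u y / 2" if "y \<in> S" for y
    using pull_grad_prod[OF c(1) W(1) su su that[unfolded S_def]] by simp
  have L: "(?L \<circ> chart_inv c) y = laplace_coeff M c u y - grad_prod_coeff M c u \<psi> y" if y: "y \<in> S" for y
  proof -
    obtain q where q: "q \<in> fst c" "q \<in> W" "y = snd c q" using y unfolding S_def by blast
    have "laplacian M u q = laplace_coeff M c u y"
      using laplacian_eq[OF c(1) q(1) smooth_nearI[OF W(1) su q(2)]] q by simp
    then show ?thesis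
      using pull_grad_prod[OF c(1) W(1) su s\<psi> y[unfolded S_def]] c q by (simp add: weighted_laplacian_def)
  qed
  have Lp: "?L p = laplace_coeff M c u x - grad_prod_coeff M c u \<psi> x"
    using L[OF x] c by (simp add: x_def)
  have pE: "partial k (?E \<circ> chart_inv c) x = (\<Sum>a\<in>UNIV. ?h u k a * ?X u a)" for k
  proof -
    have "partial k (?E \<circ> chart_inv c) x = partial k (\<lambda>y. grad_prod_coeff M c u u y * (1/2)) x"
      by (rule partial_cong[OF P.open_S x]) (use smooth_in_pull[OF sE c(1)] E in \<open>auto simp: S_def\<close>)
    also have "\<dots> = partial k (grad_prod_coeff M c u u) x / 2"
      by (subst partial_mult[OF P.smooth_grad_prod[OF pu pu] smooth_on_const x]) (simp add: partial_const)
    finally show ?thesis by (simp add: P.partial_grad_prod[OF x pu pu])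
  qed
  have pL: "partial k (?L \<circ> chart_inv c) x = partial k (laplace_coeff M c u) x
      - ((\<Sum>a\<in>UNIV. ?h u k a * ?X \<psi> a) + (\<Sum>a\<in>UNIV. ?h \<psi> k a * ?X u a))" for k
  proof -
    have "partial k (?L \<circ> chart_inv c) x
        = partial k (\<lambda>y. laplace_coeff M c u y - grad_prod_coeff M c u \<psi> y) x"
      by (rule partial_cong[OF P.open_S x]) (use smooth_in_pull[OF sL c(1)] L in \<open>auto simp: S_def\<close>)
    also have "\<dots> = partial k (laplace_coeff M c u) x - partial k (grad_prod_coeff M c u \<psi>) x"
      by (rule partial_diff[OF P.smooth_laplace[OF pu] P.smooth_grad_prod[OF pu p\<psi>] x])
    finally show ?thesis by (simp add: P.partial_grad_prod[OF x pu p\<psi>])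
  qed
  \<comment> \<open>\<open>R\<close>, \<open>Q\<close>, \<open>Z\<close>, \<open>D\<close> and \<open>n2\<close> are \<open>Ric(\<nabla>u, \<nabla>u)\<close>, \<open>Hess \<psi>(\<nabla>u, \<nabla>u)\<close>, \<open>Hess u(\<nabla>u, \<nabla>\<psi>)\<close>, \<open>\<langle>\<nabla>u, \<nabla>\<Delta>u\<rangle>\<close> and
      \<open>|Hess u|\<^sup>2\<close> at \<open>p\<close>.\<close>
  define R where "R = (\<Sum>i\<in>UNIV. \<Sum>j\<in>UNIV. ricci_coeff M c i j x * ?X u i * ?X u j)"
  define Q where "Q = (\<Sum>i\<in>UNIV. \<Sum>j\<in>UNIV. ?h \<psi> i j * ?X u i * ?X u j)"
  define Z where "Z = (\<Sum>i\<in>UNIV. \<Sum>j\<in>UNIV. ?h u i j * ?X u i * ?X \<psi> j)"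
  define D where "D = (\<Sum>k\<in>UNIV. ?X u k * partial k (laplace_coeff M c u) x)"
  define n2 where "n2 = (\<Sum>i\<in>UNIV. \<Sum>k\<in>UNIV. hess_endo M c u i k x * hess_endo M c u k i x)"
  have Z': "(\<Sum>k\<in>UNIV. ?X \<psi> k * (\<Sum>a\<in>UNIV. ?h u k a * ?X u a)) = Z"
    unfolding Z_def sum_distrib_left
    by (subst sum.swap, intro sum.cong refl) (simp add: P.hess_sym[OF x pu] mult_ac)
  have "laplacian M ?E p = D + R + n2"
    unfolding D_def R_def n2_def laplacian_eq[OF c near[OF sE]] x_def[symmetric]
    by (rule P.bochner[OF x pu E])
  moreover have "grad_prod M ?E \<psi> p = Z"
    unfolding grad_prod_commute[OF p near[OF sE] near[OF s\<psi>]] grad_prod_eq[OF c near[OF s\<psi>] near[OF sE]]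
      grad_prod_coeff_def x_def[symmetric] pE Z' ..
  moreover have "grad_prod M ?L u p = D - (Z + Q)"
    unfolding grad_prod_commute[OF p near[OF sL] near[OF su]] grad_prod_eq[OF c near[OF su] near[OF sL]]
      grad_prod_coeff_def x_def[symmetric] pL D_def Z_def Q_def
    by (simp add: right_diff_distrib distrib_left sum_subtractf sum.distrib sum_distrib_left mult_ac)
  ultimately have 1: "weighted_laplacian M \<psi> ?E p - grad_prod M ?L u p = R + Q + n2"
    by (simp add: weighted_laplacian_def)
  have comp: "vcomp c (gradient M u p) i = ?X u i" for i
    unfolding gradient_eq[OF c near[OF su]] using c by (simp add: x_def)
  have ric: "Ric M p (gradient M u p) (gradient M u p) = R"
    and hess: "Hess M \<psi> p (gradient M u p) (gradient M u p) = Q"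
    unfolding Ric_def Hess_def Let_def c_def[symmetric] comp R_def Q_def x_def by simp_all
  define t where "t = laplace_coeff M c u x"
  define b where "b = grad_prod_coeff M c u \<psi> x"
  have b: "grad_prod M \<psi> u p = b"
    unfolding grad_prod_commute[OF p near[OF s\<psi>] near[OF su]] grad_prod_eq[OF c near[OF su] near[OF s\<psi>]] b_def x_def ..
  have "n2 \<ge> t\<^sup>2 / real CARD('n)"
    unfolding n2_def t_def by (rule P.hess_norm_ge[OF x pu])
  moreover have "t\<^sup>2 / real CARD('n) \<ge> - (b\<^sup>2 / (N - real CARD('n))) + (t - b)\<^sup>2 / N"
    by (rule weighted_square_ineq[OF _ N]) simp
  ultimately show ?thesis
    unfolding 1 weighted_Ric_def ric hess b Lp t_def[symmetric] b_def[symmetric] by simp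
qed

end

theorem theorem4p1:
  fixes M :: "('a, 'n::finite) riem_manifold"
    and \<psi> u :: "'a \<Rightarrow> real" and \<mm> :: "'a measure" and N :: real
  assumes "riemannian_manifold M"
    and "connected_space (mtop M)"
    and "complete_riemannian M"
    and "CARD('n) \<ge> 2"
    and "smooth_fun M \<psi>"
    and "\<mm> = weighted_volume M \<psi>"
    and "smooth_fun M u"
    and "N < 0"
  shows "\<forall>p\<in>topspace (mtop M).
    weighted_laplacian M \<psi> (\<lambda>q. gmetric M q (gradient M u q) (gradient M u q) / 2) p
      - gmetric M p (gradient M (weighted_laplacian M \<psi> u) p) (gradient M u p)
    \<ge> weighted_Ric M \<psi> N p (gradient M u p) + (weighted_laplacian M \<psi> u p)\<^sup>2 / N"
proof
  interpret riemannian M by standard (rule assms(1))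
  fix p assume "p \<in> topspace (mtop M)"
  then show "weighted_laplacian M \<psi> (\<lambda>q. gmetric M q (gradient M u q) (gradient M u q) / 2) p
      - gmetric M p (gradient M (weighted_laplacian M \<psi> u) p) (gradient M u p)
    \<ge> weighted_Ric M \<psi> N p (gradient M u p) + (weighted_laplacian M \<psi> u p)\<^sup>2 / N"
    by (rule weighted_bochner_ineq[OF _ assms(5,7,8)])
qed

end
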